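(* Let $\Gamma$ be an orderable group. If the space of orderings $\mathcal{LO}(\Gamma)$ is infinite, then it is uncountable.
   Context: An ordering on a group $\Gamma$ is a total order relation invariant under left multiplication; $\Gamma$ is orderable if it admits at least one ordering. $\mathcal{LO}(\Gamma)$ denotes the set of all orderings on $\Gamma$. The group $\Gamma$ is not assumed countable. *)

theory Defs
  imports "HOL-Algebra.Group" "HOL-Library.Countable_Set"
begin

text \<open>
  Orderings are reflexive (non-strict) total orders, represented by their graphs. Since
  \<^const>\<open>linear_order_on\<close> confines the graph to the carrier, distinct members of \<open>LO \<Gamma>\<close>
  are distinct orderings of the group.
\<close>

definition group_ordering :: "('a, 'b) monoid_scheme \<Rightarrow> 'a rel \<Rightarrow> bool" where
  "group_ordering \<Gamma> r \<longleftrightarrow>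
     linear_order_on (carrier \<Gamma>) r \<and>
     (\<forall>f\<in>carrier \<Gamma>. \<forall>g\<in>carrier \<Gamma>. \<forall>h\<in>carrier \<Gamma>.
        (g, h) \<in> r \<longrightarrow> (f \<otimes>\<^bsub>\<Gamma>\<^esub> g, f \<otimes>\<^bsub>\<Gamma>\<^esub> h) \<in> r)"

definition orderable :: "('a, 'b) monoid_scheme \<Rightarrow> bool" where
  "orderable \<Gamma> \<longleftrightarrow> (\<exists>r. group_ordering \<Gamma> r)"

definition LO :: "('a, 'b) monoid_scheme \<Rightarrow> 'a rel set" where
  "LO \<Gamma> = {r. group_ordering \<Gamma> r}"

end

theory Submission
  imports
    Defs
    "HOL-Algebra.Coset"
    "HOL-Algebra.Generated_Groups"
    "HOL-Analysis.Continuum_Not_Denumerable"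
begin

text \<open>
  The proof shows that a group with countably many orderings has only finitely many. Orderings are
  encoded by their positive cones, and three constructions each turn a failure of rigidity into
  uncountably many orderings.

  First, every ordering must satisfy Conrad's condition: for \<open>f \<ge> \<one>\<close> and any \<open>g\<close>, some power of \<open>g\<close>
  satisfies \<open>f g\<^sup>n \<ge> g\<close>. Otherwise \<open>f\<close> and \<open>g\<close> map an interval of the ordered group into disjoint
  subintervals, the infinite words in two such maps determine a Cantor set of cuts, and ordering the
  group by its action on these cuts gives pairwise different orderings
  (\<open>uncountable_cones_if_not_conradian\<close>).

  Secondly, in a Conradian ordering the convex hull of every cyclic subgroup is a subgroup. The signs
  of all elements with a given hull can be reversed independently of the others (\<open>flip_cone\<close>), so there are
  only finitely many hulls (\<open>finite_levels\<close>). In particular,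
    if the group is nontrivial, there is a largest proper
  convex subgroup \<open>C\<close>; it is normal, and the quotient by it is Archimedean, hence abelian
    by Hoelder's
  theorem (\<open>abelian_mod_small_part\<close>).

  Thirdly, a torsion-free abelian group of rank at least two has an ordering for every real slope, and
  orderings of a quotient
    by a normal subgroup lift to an orderable group. Hence abelian torsion-free
  quotients have rank at most one (\<open>dependent_mod\<close>). Applied to the quotient
    by the intersection of the
  largest proper convex subgroups of two orderings, this
    shows that both orderings have the same \<open>C\<close>;
  applied to the quotient by \<open>C\<close>, it shows that an ordering is determined
    by its restriction to \<open>C\<close> and
  the sign of a single element outside \<open>C\<close>. As \<open>C\<close> has fewer convex subgroups and again only
  countably many orderings, finiteness follows by induction.
\<close>

section \<open>Positive cones\<close>

definition positive_cone :: "('a, 'b) monoid_scheme \<Rightarrow> 'a set \<Rightarrow> bool" where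
  "positive_cone G P \<longleftrightarrow> P \<subseteq> carrier G \<and> \<one>\<^bsub>G\<^esub> \<notin> P \<and> (\<forall>x\<in>P. \<forall>y\<in>P. x \<otimes>\<^bsub>G\<^esub> y \<in> P) \<and>
     (\<forall>x\<in>carrier G. x \<noteq> \<one>\<^bsub>G\<^esub> \<longrightarrow> x \<in> P \<or> inv\<^bsub>G\<^esub> x \<in> P)"

definition cones :: "('a, 'b) monoid_scheme \<Rightarrow> 'a set set" where
  "cones G = {P. positive_cone G P}"

locale left_ordered_group = group +
  fixes P
  assumes cone: "positive_cone G P"
begin

text \<open>
  Membership in the carrier is part of both relations, so that transitivity holds without side
  conditions and chains of inequalities carry the carrier facts along.
\<close>

definition less :: "'a \<Rightarrow> 'a \<Rightarrow> bool" (infix "\<prec>" 50) where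
  "x \<prec> y \<longleftrightarrow> x \<in> carrier G \<and> y \<in> carrier G \<and> inv x \<otimes> y \<in> P"

definition less_eq :: "'a \<Rightarrow> 'a \<Rightarrow> bool" (infix "\<preceq>" 50) where
  "x \<preceq> y \<longleftrightarrow> x \<in> carrier G \<and> y \<in> carrier G \<and> (x = y \<or> x \<prec> y)"

lemma P_carrier: "x \<in> P \<Longrightarrow> x \<in> carrier G"
  and one_notin_P: "\<one> \<notin> P"
  and P_mult: "x \<in> P \<Longrightarrow> y \<in> P \<Longrightarrow> x \<otimes> y \<in> P"
  and P_total: "x \<in> carrier G \<Longrightarrow> x \<noteq> \<one> \<Longrightarrow> x \<in> P \<or> inv x \<in> P"
  using cone by (auto simp: positive_cone_def)

lemma P_inv: "x \<in> P \<Longrightarrow> inv x \<notin> P"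
  using P_mult one_notin_P P_carrier by (metis r_inv)

lemma less_carrier: "x \<prec> y \<Longrightarrow> x \<in> carrier G" "x \<prec> y \<Longrightarrow> y \<in> carrier G"
  and le_carrier: "x \<preceq> y \<Longrightarrow> x \<in> carrier G" "x \<preceq> y \<Longrightarrow> y \<in> carrier G"
  by (auto simp: less_def less_eq_def)

lemma less_irrefl: "\<not> x \<prec> x"
  using one_notin_P by (auto simp: less_def)

lemma less_trans [trans]:
  assumes "x \<prec> y" "y \<prec> z" shows "x \<prec> z"
proof -
  have c: "x \<in> carrier G" "y \<in> carrier G" "z \<in> carrier G"
    using assms by (auto simp: less_def)
  have "(inv x \<otimes> y) \<otimes> (inv y \<otimes> z) \<in> P"
    using assms P_mult by (auto simp: less_def)
  moreover have "(inv x \<otimes> y) \<otimes> (inv y \<otimes> z) = inv x \<otimes> z"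
    using c by (simp add: m_assoc) (simp add: m_assoc [symmetric])
  ultimately show ?thesis using c by (simp add: less_def)
qed

lemma less_imp_le: "x \<prec> y \<Longrightarrow> x \<preceq> y"
  by (simp add: less_eq_def less_carrier)

lemma le_refl: "x \<in> carrier G \<Longrightarrow> x \<preceq> x"
  by (simp add: less_eq_def)

lemma le_trans [trans]: "x \<preceq> y \<Longrightarrow> y \<preceq> z \<Longrightarrow> x \<preceq> z"
  and le_less_trans [trans]: "x \<preceq> y \<Longrightarrow> y \<prec> z \<Longrightarrow> x \<prec> z"
  and less_le_trans [trans]: "x \<prec> y \<Longrightarrow> y \<preceq> z \<Longrightarrow> x \<prec> z"
  unfolding less_eq_def by (metis less_trans)+

lemma less_linear: "x \<in> carrier G \<Longrightarrow> y \<in> carrier G \<Longrightarrow> x \<prec> y \<or> x = y \<or> y \<prec> x"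
proof -
  assume c: "x \<in> carrier G" "y \<in> carrier G"
  have "inv (inv x \<otimes> y) = inv y \<otimes> x" using c by (simp add: inv_mult_group)
  moreover have "inv x \<otimes> y = \<one> \<Longrightarrow> x = y" using c by (simp add: inv_solve_left')
  ultimately show ?thesis using P_total [of "inv x \<otimes> y"] c unfolding less_def by force
qed

lemma not_less: "x \<in> carrier G \<Longrightarrow> y \<in> carrier G \<Longrightarrow> \<not> x \<prec> y \<longleftrightarrow> y \<preceq> x"
  unfolding less_eq_def by (metis less_linear less_irrefl less_trans)

lemma not_le: "x \<in> carrier G \<Longrightarrow> y \<in> carrier G \<Longrightarrow> \<not> x \<preceq> y \<longleftrightarrow> y \<prec> x"
  using not_less by blast

lemma le_antisym: "x \<preceq> y \<Longrightarrow> y \<preceq> x \<Longrightarrow> x = y"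
  unfolding less_eq_def by (metis less_trans less_irrefl)

lemma mult_less_cancel:
  assumes "a \<in> carrier G" "x \<in> carrier G" "y \<in> carrier G"
  shows "a \<otimes> x \<prec> a \<otimes> y \<longleftrightarrow> x \<prec> y"
proof -
  have "inv (a \<otimes> x) \<otimes> (a \<otimes> y) = inv x \<otimes> y"
    using assms by (simp add: inv_mult_group m_assoc) (simp add: m_assoc [symmetric])
  then show ?thesis using assms by (simp add: less_def)
qed

lemma mult_le_cancel:
  assumes "a \<in> carrier G" "x \<in> carrier G" "y \<in> carrier G"
  shows "a \<otimes> x \<preceq> a \<otimes> y \<longleftrightarrow> x \<preceq> y"
  using assms mult_less_cancel by (simp add: less_eq_def)

lemma P_iff: "x \<in> P \<longleftrightarrow> \<one> \<prec> x"
  using P_carrier by (auto simp: less_def)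

lemma mult_less_left: "x \<prec> y \<Longrightarrow> a \<in> carrier G \<Longrightarrow> a \<otimes> x \<prec> a \<otimes> y"
  and mult_le_left: "x \<preceq> y \<Longrightarrow> a \<in> carrier G \<Longrightarrow> a \<otimes> x \<preceq> a \<otimes> y"
  by (simp_all add: mult_less_cancel mult_le_cancel less_carrier le_carrier)

lemma inv_le_one: "\<one> \<preceq> x \<Longrightarrow> inv x \<preceq> \<one>"
  using mult_le_left [of \<one> x "inv x"] le_carrier by auto

lemma inv_ge_one: "x \<preceq> \<one> \<Longrightarrow> \<one> \<preceq> inv x"
  using mult_le_left [of x \<one> "inv x"] le_carrier by auto

lemma pow_ge_one: "\<one> \<preceq> x \<Longrightarrow> \<one> \<preceq> x [^] (n::nat)"
proof (induction n)
  case (Suc n)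
  have x: "x \<in> carrier G" using Suc le_carrier by blast
  have "\<one> \<preceq> x [^] n" using Suc by simp
  also have "\<dots> \<preceq> x [^] n \<otimes> x" using mult_le_left [OF Suc.prems, of "x [^] n"] x by simp
  finally show ?case by simp
qed (auto intro: le_refl)

end

text \<open>
  The reversed ordering, through which the crossing argument below also yields its dual.
\<close>

lemma positive_cone_inv:
  assumes "group G" "positive_cone G P"
  shows "positive_cone G {x \<in> carrier G. inv\<^bsub>G\<^esub> x \<in> P}"
proof -
  interpret left_ordered_group G P using assms
    by (simp add: left_ordered_group_def left_ordered_group_axioms_def)
  show ?thesis
    unfolding positive_cone_def
    using P_total P_mult one_notin_P by (auto simp: inv_mult_group)
qed

definition ordering_of_cone :: "('a, 'b) monoid_scheme \<Rightarrow> 'a set \<Rightarrow> 'a rel" where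
  "ordering_of_cone G P = {(x, y). x \<in> carrier G \<and> y \<in> carrier G \<and> (x = y \<or> inv\<^bsub>G\<^esub> x \<otimes>\<^bsub>G\<^esub> y \<in> P)}"

definition cone_of_ordering :: "('a, 'b) monoid_scheme \<Rightarrow> 'a rel \<Rightarrow> 'a set" where
  "cone_of_ordering G r = {x. (\<one>\<^bsub>G\<^esub>, x) \<in> r \<and> x \<noteq> \<one>\<^bsub>G\<^esub>}"

lemma ordering_of_cone_in_LO:
  assumes "group G" "P \<in> cones G"
  shows "ordering_of_cone G P \<in> LO G"
proof -
  interpret left_ordered_group G P
    using assms by (simp add: left_ordered_group_def left_ordered_group_axioms_def cones_def)
  have eq: "ordering_of_cone G P = {(x, y). x \<preceq> y}"
    by (auto simp: ordering_of_cone_def less_eq_def less_def)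
  show ?thesis
    unfolding LO_def group_ordering_def linear_order_on_def partial_order_on_def preorder_on_def
  proof (intro CollectI conjI ballI impI)
    show "ordering_of_cone G P \<subseteq> carrier G \<times> carrier G"
      by (auto simp: eq le_carrier)
    show "refl_on (carrier G) (ordering_of_cone G P)"
      by (auto simp: eq refl_on_def le_refl)
    show "trans (ordering_of_cone G P)"
      by (auto simp: eq intro: transI le_trans)
    show "antisym (ordering_of_cone G P)"
      by (auto simp: eq intro: antisymI le_antisym)
    show "total_on (carrier G) (ordering_of_cone G P)"
      using not_le less_imp_le by (auto simp: eq total_on_def)
  qed (auto simp: eq mult_le_left)
qed

lemma cone_of_ordering_of_cone:
  assumes "group G" "P \<in> cones G"
  shows "cone_of_ordering G (ordering_of_cone G P) = P"
proof -
  interpret left_ordered_group G P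
    using assms by (simp add: left_ordered_group_def left_ordered_group_axioms_def cones_def)
  show ?thesis
    using P_carrier one_notin_P by (auto simp: cone_of_ordering_def ordering_of_cone_def)
qed

text \<open>
  Left invariance gives \<open>x \<le> y\<close> iff \<open>\<one> \<le> inv x \<otimes> y\<close>, so an ordering is recovered from the elements
  above the identity. Orderings can therefore be counted by counting cones, and cones are what
  the constructions below produce.
\<close>

lemma LO_conv:
  fixes G (structure)
  assumes "group G" "r \<in> LO G"
  shows "cone_of_ordering G r \<in> cones G" "ordering_of_cone G (cone_of_ordering G r) = r"
proof -
  interpret group G by fact
  have lin: "linear_order_on (carrier G) r"
    and lm: "\<And>a x y. a \<in> carrier G \<Longrightarrow> x \<in> carrier G \<Longrightarrow> y \<in> carrier G \<Longrightarrow> (x,y) \<in> r \<Longrightarrow> (a \<otimes> x, a \<otimes> y) \<in> r"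
    using assms(2) by (auto simp: LO_def group_ordering_def)
  have po: "partial_order_on (carrier G) r" and "total_on (carrier G) r"
    using lin by (auto simp: linear_order_on_def)
  note po' = partial_order_onD [OF po]
  have sub: "r \<subseteq> carrier G \<times> carrier G" by (rule po'(4))
  have re: "(x,x) \<in> r" if "x \<in> carrier G" for x using po'(1) that by (rule refl_onD)
  have tr: "(x,z) \<in> r" if "(x,y) \<in> r" "(y,z) \<in> r" for x y z using po'(2) that by (rule transD)
  have as: "x = y" if "(x,y) \<in> r" "(y,x) \<in> r" for x y using po'(3) that by (rule antisymD)
  have tot: "(x,y) \<in> r \<or> (y,x) \<in> r" if "x \<in> carrier G" "y \<in> carrier G" for x y
    using \<open>total_on (carrier G) r\<close> re that unfolding total_on_def by (cases "x = y") blast+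
  have lm': "(x, y) \<in> r \<longleftrightarrow> (\<one>, inv x \<otimes> y) \<in> r" if "x \<in> carrier G" "y \<in> carrier G" for x y
  proof
    show "(x, y) \<in> r \<Longrightarrow> (\<one>, inv x \<otimes> y) \<in> r"
      using lm [of "inv x" x y] that by simp
    show "(\<one>, inv x \<otimes> y) \<in> r \<Longrightarrow> (x, y) \<in> r"
      using lm [of x \<one> "inv x \<otimes> y"] that by (simp add: m_assoc [symmetric])
  qed
  show "ordering_of_cone G (cone_of_ordering G r) = r"
  proof (simp only: set_eq_iff split_paired_All, intro allI)
    fix x y
    show "(x, y) \<in> ordering_of_cone G (cone_of_ordering G r) \<longleftrightarrow> (x, y) \<in> r"
    proof (cases "x \<in> carrier G \<and> y \<in> carrier G")
      case True
      then have "inv x \<otimes> y = \<one> \<longleftrightarrow> x = y" using inv_solve_left' [of \<one> x y] by auto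
      then show ?thesis
        using True lm' [of x y] re by (auto simp: cone_of_ordering_def ordering_of_cone_def)
    qed (use sub in \<open>auto simp: ordering_of_cone_def\<close>)
  qed
  have "x \<otimes> y \<in> cone_of_ordering G r"
    if "x \<in> cone_of_ordering G r" "y \<in> cone_of_ordering G r" for x y
  proof -
    have c: "x \<in> carrier G" "y \<in> carrier G" using that sub by (auto simp: cone_of_ordering_def)
    have 1: "(\<one>, x) \<in> r" "(x, x \<otimes> y) \<in> r" "x \<noteq> \<one>"
      using that lm [of x \<one> y] c by (auto simp: cone_of_ordering_def)
    then have "(\<one>, x \<otimes> y) \<in> r" "x \<otimes> y \<noteq> \<one>" using tr as by metis+
    then show ?thesis by (simp add: cone_of_ordering_def)
  qed
  moreover have "x \<in> cone_of_ordering G r \<or> inv x \<in> cone_of_ordering G r"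
    if "x \<in> carrier G" "x \<noteq> \<one>" for x
    using tot [of \<one> x] lm [of "inv x" x \<one>] that by (auto simp: cone_of_ordering_def)
  ultimately show "cone_of_ordering G r \<in> cones G"
    using sub by (auto simp: cones_def positive_cone_def) (auto simp: cone_of_ordering_def)
qed

lemma countable_cones:
  assumes "group G" "countable (LO G)" shows "countable (cones G)"
proof -
  have "cones G \<subseteq> cone_of_ordering G ` LO G"
    using ordering_of_cone_in_LO [OF assms(1)] cone_of_ordering_of_cone [OF assms(1), symmetric]
    by (blast intro: image_eqI)
  then show ?thesis using countable_subset [OF _ countable_image [OF assms(2)]] by blast
qed

lemma finite_LO:
  assumes "group G" "finite (cones G)" shows "finite (LO G)"
proof -
  have "LO G \<subseteq> ordering_of_cone G ` cones G"
    using LO_conv(1) [OF assms(1)] LO_conv(2) [OF assms(1), symmetric] by (blast intro: image_eqI)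
  then show ?thesis using finite_subset [OF _ finite_imageI [OF assms(2)]] by blast
qed

lemma left_ordered_groupI: "group G \<Longrightarrow> P \<in> cones G \<Longrightarrow> left_ordered_group G P"
  by (simp add: left_ordered_group_def left_ordered_group_axioms_def cones_def)

section \<open>Orderings coded by binary sequences\<close>

lemma uncountable_nat_predicates: "uncountable (UNIV :: (nat \<Rightarrow> bool) set)"
proof
  assume "countable (UNIV :: (nat \<Rightarrow> bool) set)"
  then obtain e :: "nat \<Rightarrow> nat \<Rightarrow> bool" where e: "range e = UNIV"
    using uncountable_def by blast
  then obtain n where "(\<lambda>k. \<not> e k k) = e n" by (metis UNIV_I rangeE)
  then show False by (metis (full_types))
qed

primrec (in monoid) partial_product :: "(nat \<Rightarrow> 'a) \<Rightarrow> nat \<Rightarrow> 'a" where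
  "partial_product t 0 = \<one>"
| "partial_product t (Suc n) = partial_product t n \<otimes> t n"

lemma (in group) l_coset_mono_iff:
  assumes "h \<in> carrier G" "A \<subseteq> carrier G" "B \<subseteq> carrier G"
  shows "h <# A \<subseteq> h <# B \<longleftrightarrow> A \<subseteq> B"
proof
  assume "h <# A \<subseteq> h <# B"
  then have "inv h <# (h <# A) \<subseteq> inv h <# (h <# B)"
    unfolding l_coset_def by blast
  then show "A \<subseteq> B" using assms by (simp add: lcos_m_assoc lcos_mult_one)
qed (auto simp: l_coset_def)

context left_ordered_group
begin

text \<open>
  The group acts on the chain of down-closed sets, so it can be ordered by the direction in which
  its elements move a fixed such set \<open>D\<close>, with \<open>P\<close> deciding on the stabiliser of \<open>D\<close>. If \<open>D\<close> consists
  of the elements up to some \<open>y\<close>, this is the conjugate of \<open>P\<close> by \<open>y\<close>; a set without a largest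
  element plays the part of a limit of conjugates.
\<close>

definition cut_cone :: "'a set \<Rightarrow> 'a set" where
  "cut_cone D = {h \<in> carrier G. D \<subset> h <# D \<or> (h \<in> P \<and> h <# D = D)}"

definition down_closed :: "'a set \<Rightarrow> bool" where
  "down_closed D \<longleftrightarrow> D \<subseteq> carrier G \<and> (\<forall>y\<in>D. \<forall>x. x \<preceq> y \<longrightarrow> x \<in> D)"

text \<open>
  Left multiplication is an order automorphism, so \<open>h <# D\<close> is again down-closed, and the
  down-closed subsets of a total order form a chain.
\<close>

lemma cut_comparable:
  assumes "down_closed D" and h: "h \<in> carrier G"
  shows "D \<subseteq> h <# D \<or> h <# D \<subseteq> D"
proof (cases "D \<subseteq> h <# D")
  case False
  have D: "D \<subseteq> carrier G" "\<And>x y. y \<in> D \<Longrightarrow> x \<preceq> y \<Longrightarrow> x \<in> D"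
    using assms(1) by (auto simp: down_closed_def)
  from False obtain y where y: "y \<in> D" "y \<notin> h <# D" by blast
  have "h <# D \<subseteq> D"
  proof
    fix x assume "x \<in> h <# D"
    then obtain z where z: "z \<in> D" "x = h \<otimes> z" by (auto simp: l_coset_def)
    have c: "y \<in> carrier G" "z \<in> carrier G" using y z D by auto
    have "\<not> y \<preceq> h \<otimes> z"
    proof
      assume "y \<preceq> h \<otimes> z"
      then have "inv h \<otimes> y \<preceq> z" using mult_le_left [of y "h \<otimes> z" "inv h"] h c
        by (simp add: m_assoc [symmetric])
      then have "inv h \<otimes> y \<in> D" using D z by blast
      then have "h \<otimes> (inv h \<otimes> y) \<in> h <# D" by (auto simp: l_coset_def)
      then show False using y h c by (simp add: m_assoc [symmetric])
    qed
    then have "x \<preceq> y" using not_le less_imp_le c h z by auto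
    then show "x \<in> D" using D y by blast
  qed
  then show ?thesis ..
qed simp

lemma cut_cone:
  assumes down: "down_closed D"
  shows "cut_cone D \<in> cones G"
proof -
  have D: "D \<subseteq> carrier G" using down by (simp add: down_closed_def)
  have "x \<otimes> y \<in> cut_cone D" if "x \<in> cut_cone D" "y \<in> cut_cone D" for x y
  proof -
    have c: "x \<in> carrier G" "y \<in> carrier G" and Dx: "D \<subseteq> x <# D" and Dy: "D \<subseteq> y <# D"
      using that by (auto simp: cut_cone_def)
    have eq: "(x \<otimes> y) <# D = x <# (y <# D)" using c D by (simp add: lcos_m_assoc)
    have yD: "y <# D \<subseteq> carrier G" using c D by (auto simp: l_coset_def)
    have 1: "x <# D \<subseteq> x <# (y <# D)" using Dy c D yD by (simp add: l_coset_mono_iff)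
    show ?thesis
    proof (cases "x <# (y <# D) = D")
      case True
      then have xD: "x <# D = D" using 1 Dx by auto
      then have "x <# (y <# D) \<subseteq> x <# D" using True by simp
      then have "y <# D = D" using Dy c D yD by (simp add: l_coset_mono_iff)
      then show ?thesis using xD that c eq True P_mult by (auto simp: cut_cone_def)
    next
      case False
      then show ?thesis using 1 Dx c eq by (auto simp: cut_cone_def)
    qed
  qed
  moreover have "x \<in> cut_cone D \<or> inv x \<in> cut_cone D" if "x \<in> carrier G" "x \<noteq> \<one>" for x
  proof -
    have xD: "x <# D \<subseteq> carrier G" using that D by (auto simp: l_coset_def)
    have i: "inv x <# (x <# D) = D" using that D by (simp add: lcos_m_assoc lcos_mult_one)
    have "x <# D \<subset> D \<Longrightarrow> D \<subset> inv x <# D"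
      using l_coset_mono_iff [of "inv x" "x <# D" D] l_coset_mono_iff [of "inv x" D "x <# D"] that D xD i
      by auto
    moreover have "x <# D = D \<Longrightarrow> inv x <# D = D" using i by simp
    ultimately show ?thesis using cut_comparable [OF down that(1)] P_total [OF that] that
      by (auto simp: cut_cone_def)
  qed
  moreover have "\<one> \<notin> cut_cone D"
    using D one_notin_P by (auto simp: cut_cone_def lcos_mult_one)
  ultimately show ?thesis
    by (auto simp: cones_def positive_cone_def) (auto simp: cut_cone_def)
qed

text \<open>
  The failure of Conrad's condition is a ping-pong situation. On the interval
  \<open>J = {y. \<one> \<le> y < g\<^sup>n for some n}\<close> both \<open>f\<close> and \<open>g\<close> act as self-maps, and \<open>f J\<close> lies entirely
  below \<open>g\<close>, hence below \<open>g J\<close>. So \<open>f f J < f g J < g J\<close>, and nested words in the two outer maps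
  \<open>f f\<close> and \<open>g\<close> code binary sequences as in the Cantor set. The word prefixes of a sequence \<open>s\<close>
  increase and define a cut. To read off the bit \<open>s m\<close> from the ordering at that cut,
  conjugate the middle map \<open>f g\<close> by the prefix of length \<open>m\<close>: it moves everything towards the middle
  interval, so it moves the cut up if the cut lies in the left interval and down if it lies in the
  right one.
\<close>

theorem uncountable_cones_if_not_conradian:
  assumes f: "\<one> \<preceq> f" and g: "g \<in> carrier G" and fg: "\<And>n::nat. f \<otimes> g [^] n \<prec> g"
  shows "uncountable (cones G)"
proof -
  have fc: "f \<in> carrier G" using f le_carrier by blast
  have "f \<prec> g" using fg [of 0] fc by simp
  then have g1: "\<one> \<prec> g" using f le_less_trans by blast
  define J where "J = {y. \<one> \<preceq> y \<and> (\<exists>n::nat. y \<prec> g [^] n)}"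
  have Jc: "y \<in> carrier G" if "y \<in> J" for y using that by (auto simp: J_def less_carrier)
  have one_J: "\<one> \<in> J" using g1 g by (auto simp: J_def le_refl intro!: exI [of _ "1::nat"])
  have fJ: "f \<otimes> y \<in> J" and fJ_less: "f \<otimes> y \<prec> g" if y: "y \<in> J" for y
  proof -
    obtain n where n: "\<one> \<preceq> y" "y \<prec> g [^] (n::nat)" using y by (auto simp: J_def)
    note f
    also have "f \<preceq> f \<otimes> y" using mult_le_left [OF n(1) fc] fc by simp
    finally have 1: "\<one> \<preceq> f \<otimes> y" .
    have "f \<otimes> y \<prec> f \<otimes> g [^] n" by (rule mult_less_left [OF n(2) fc])
    also note fg
    finally show "f \<otimes> y \<prec> g" .
    then have "f \<otimes> y \<prec> g [^] (1::nat)" using g by simp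
    with 1 show "f \<otimes> y \<in> J" unfolding J_def by blast
  qed
  have gJ: "g \<otimes> y \<in> J" and gJ_le: "g \<preceq> g \<otimes> y" if y: "y \<in> J" for y
  proof -
    obtain n where n: "\<one> \<preceq> y" "y \<prec> g [^] (n::nat)" using y by (auto simp: J_def)
    show 1: "g \<preceq> g \<otimes> y" using mult_le_left [OF n(1) g] g by simp
    have "\<one> \<preceq> g \<otimes> y" using le_trans [OF less_imp_le [OF g1] 1] .
    moreover have "g \<otimes> y \<prec> g [^] Suc n"
      using mult_less_left [OF n(2) g] g by (simp only: nat_pow_Suc2)
    ultimately show "g \<otimes> y \<in> J" unfolding J_def by blast
  qed
  \<comment> \<open>The bit \<open>True\<close> selects the right interval \<open>g J\<close>, the bit \<open>False\<close> the left one \<open>f f J\<close>.\<close>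
  define t where "t s i = (if s i then g else f \<otimes> f)" for s :: "nat \<Rightarrow> bool" and i
  define w where "w s = partial_product (t s)" for s
  have tc: "t s i \<in> carrier G" for s i using fc g by (simp add: t_def)
  have wc: "w s n \<in> carrier G" for s n by (induction n) (auto simp: w_def tc)
  have tJ: "t s i \<otimes> y \<in> J" if "y \<in> J" for s i y
    using fJ [OF fJ [OF that]] gJ [OF that] fc Jc [OF that] by (simp add: t_def m_assoc)
  have factor: "\<exists>z\<in>J. w s n \<otimes> y = w s m \<otimes> z" if "m \<le> n" "y \<in> J" for s m n y
    using that
  proof (induction n arbitrary: y rule: dec_induct)
    case (step n)
    have "w s (Suc n) \<otimes> y = w s n \<otimes> (t s n \<otimes> y)"
      using wc [of s n] tc [of s n] Jc [OF step.prems] by (simp add: w_def m_assoc)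
    then show ?case using step.IH [OF tJ [OF step.prems]] by simp
  qed auto
  have factor_one: "\<exists>z\<in>J. w s n = w s m \<otimes> z" if "m \<le> n" for s m n
    using factor [OF that one_J] wc by simp
  have w_mono: "w s m \<preceq> w s n" if mn: "m \<le> n" for s m n
  proof -
    obtain z where z: "z \<in> J" "w s n = w s m \<otimes> z" using factor_one [OF mn] by blast
    then have "\<one> \<preceq> z" by (simp add: J_def)
    then show ?thesis using mult_le_left [of \<one> z "w s m"] wc z by simp
  qed
  define D where "D s = {y. \<exists>n. y \<preceq> w s n}" for s
  have D: "down_closed (D s)" for s
    unfolding down_closed_def D_def using le_carrier(1) le_trans by blast
  have wD: "w s n \<in> D s" for s n using wc le_refl by (auto simp: D_def)
  have D_late: "\<exists>n\<ge>m. y \<preceq> w s n" if y: "y \<in> D s" for y s m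
  proof -
    obtain n where "y \<preceq> w s n" using y by (auto simp: D_def)
    then have "y \<preceq> w s (max m n)" using w_mono [of n "max m n" s] le_trans by simp
    then show ?thesis by (intro exI [of _ "max m n"]) simp
  qed
  \<comment> \<open>The element whose sign encodes the bit \<open>s m\<close>. It depends only on the bits before \<open>m\<close>.\<close>
  define c where "c s m = w s m \<otimes> (f \<otimes> g) \<otimes> inv (w s m)" for s m
  have cc: "c s m \<in> carrier G" for s m using wc fc g by (simp add: c_def)
  have c_w: "c s m \<otimes> (w s m \<otimes> z) = w s m \<otimes> (f \<otimes> (g \<otimes> z))" if "z \<in> carrier G" for s m z
  proof -
    have "inv (w s m) \<otimes> (w s m \<otimes> z) = z" using wc that by (simp add: m_assoc [symmetric])
    then show ?thesis using wc [of s m] that fc g by (simp add: c_def m_assoc)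
  qed
  have decode: "c s m \<in> cut_cone (D s) \<longleftrightarrow> \<not> s m" for s m
  proof (cases "s m")
    case True
    have w': "w s (Suc m) = w s m \<otimes> g" using True by (simp add: w_def t_def)
    have "w s (Suc m) \<notin> c s m <# D s"
    proof
      assume "w s (Suc m) \<in> c s m <# D s"
      then obtain y where y: "y \<in> D s" "w s (Suc m) = c s m \<otimes> y" by (auto simp: l_coset_def)
      obtain n where n: "n \<ge> Suc m" "y \<preceq> w s n" using D_late [OF y(1)] by blast
      obtain z where z: "z \<in> J" "w s n = w s (Suc m) \<otimes> z" using factor_one [OF n(1)] by blast
      have zc: "z \<in> carrier G" using Jc z by blast
      have "w s m \<otimes> g = c s m \<otimes> y" using w' y by simp
      also have "\<dots> \<preceq> c s m \<otimes> w s n" by (rule mult_le_left [OF n(2) cc])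
      also have "\<dots> = c s m \<otimes> (w s m \<otimes> (g \<otimes> z))" using z w' wc g zc by (simp add: m_assoc)
      also have "\<dots> = w s m \<otimes> (f \<otimes> (g \<otimes> (g \<otimes> z)))" using g zc by (simp add: c_w)
      also have "\<dots> \<prec> w s m \<otimes> g" by (rule mult_less_left [OF fJ_less [OF gJ [OF gJ [OF z(1)]]] wc])
      finally show False using less_irrefl by blast
    qed
    then have "\<not> D s \<subseteq> c s m <# D s" using wD by blast
    then show ?thesis using True by (auto simp: cut_cone_def)
  next
    case False
    have w': "w s (Suc m) = w s m \<otimes> (f \<otimes> f)" using False by (simp add: w_def t_def)
    have ffJ: "f \<otimes> f \<in> J" using fJ [OF fJ [OF one_J]] fc by simp
    have "c s m \<otimes> w s (Suc m) \<notin> D s"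
    proof
      assume "c s m \<otimes> w s (Suc m) \<in> D s"
      then obtain n where n: "n \<ge> Suc m" "c s m \<otimes> w s (Suc m) \<preceq> w s n" using D_late by blast
      obtain z where z: "z \<in> J" "w s n = w s (Suc m) \<otimes> z" using factor_one [OF n(1)] by blast
      have zc: "z \<in> carrier G" using Jc z by blast
      have "w s m \<otimes> (f \<otimes> g) \<preceq> w s m \<otimes> (f \<otimes> (g \<otimes> (f \<otimes> f)))"
        by (intro mult_le_left gJ_le ffJ wc fc)
      also have "\<dots> = c s m \<otimes> w s (Suc m)" using fc by (simp add: w' c_w)
      also note n(2)
      also have "w s n = w s m \<otimes> (f \<otimes> (f \<otimes> z))" using z w' wc fc zc by (simp add: m_assoc)
      also have "\<dots> \<prec> w s m \<otimes> (f \<otimes> g)"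
        by (intro mult_less_left fJ_less z wc fc)
      finally show False using less_irrefl by blast
    qed
    then have "\<not> c s m <# D s \<subseteq> D s" using wD by (auto simp: l_coset_def)
    then have "D s \<subset> c s m <# D s" using cut_comparable [OF D cc] by blast
    then show ?thesis using False cc by (auto simp: cut_cone_def)
  qed
  have "inj (\<lambda>s. cut_cone (D s))"
  proof (rule injI, rule ccontr)
    fix s s' :: "nat \<Rightarrow> bool"
    assume eq: "cut_cone (D s) = cut_cone (D s')" and "s \<noteq> s'"
    then have ex: "\<exists>m. s m \<noteq> s' m" by auto
    \<comment> \<open>At the first difference the two sequences still share the test element.\<close>
    define m where "m = (LEAST m. s m \<noteq> s' m)"
    have below: "s i = s' i" if "i < m" for i
      using not_less_Least that unfolding m_def by blast
    have m: "s m \<noteq> s' m" using LeastI_ex [OF ex] unfolding m_def .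
    have "w s i = w s' i" if "i \<le> m" for i
      using that by (induction i) (auto simp: w_def t_def below)
    then have "c s m = c s' m" by (simp add: c_def)
    then show False using decode [of s m] decode [of s' m] eq m by simp
  qed
  moreover have "range (\<lambda>s. cut_cone (D s)) \<subseteq> cones G" using cut_cone [OF D] by blast
  ultimately have "uncountable (UNIV :: (nat \<Rightarrow> bool) set) \<Longrightarrow> ?thesis"
    using countable_image_inj_on [OF countable_subset [where B = "cones G"]] by blast
  then show ?thesis using uncountable_nat_predicates by blast
qed

end

section \<open>Convex subgroups of a Conradian ordering\<close>

lemma uncountable_Pow:
  assumes "infinite A" shows "uncountable (Pow A)"
proof
  assume c: "countable (Pow A)"
  obtain f :: "nat \<Rightarrow> 'a" where f: "inj f" "range f \<subseteq> A"
    using assms infinite_countable_subset by blast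
  have "inj (\<lambda>s. f ` Collect s)"
  proof (rule injI)
    fix s t assume "f ` Collect s = f ` Collect t"
    then have "Collect s = Collect t" using f(1) by (simp add: inj_image_eq_iff)
    then show "s = t" by (auto simp: fun_eq_iff set_eq_iff)
  qed
  moreover have "range (\<lambda>s. f ` Collect s) \<subseteq> Pow A" using f(2) by auto
  ultimately have "countable (UNIV :: (nat \<Rightarrow> bool) set)"
    using countable_image_inj_on [OF countable_subset [OF _ c]] by blast
  then show False using uncountable_nat_predicates by blast
qed

text \<open>
  Conrad's condition, stated for an ordering and its reversal so that the locale is symmetric.
\<close>

locale conradian_ordered_group = left_ordered_group +
  assumes conradian: "\<And>f g. \<one> \<preceq> f \<Longrightarrow> g \<in> carrier G \<Longrightarrow> \<exists>n::nat. g \<preceq> f \<otimes> g [^] n"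
    and conradian': "\<And>f g. f \<preceq> \<one> \<Longrightarrow> g \<in> carrier G \<Longrightarrow> \<exists>n::nat. f \<otimes> g [^] n \<preceq> g"

lemma conradian_if_countable_cones:
  assumes "group G" "P \<in> cones G" "countable (cones G)"
  shows "conradian_ordered_group G P"
proof -
  interpret left_ordered_group G P using assms by (intro left_ordered_groupI)
  let ?R = "{x \<in> carrier G. inv\<^bsub>G\<^esub> x \<in> P}"
  interpret R: left_ordered_group G ?R
    using positive_cone_inv [OF assms(1) cone]
      by (intro left_ordered_groupI assms) (simp add: cones_def)
  have R: "R.less x y \<longleftrightarrow> y \<prec> x" for x y
    unfolding R.less_def less_def by (auto simp: inv_mult_group)
  have R': "R.less_eq x y \<longleftrightarrow> y \<preceq> x" for x y
    unfolding R.less_eq_def less_eq_def R by auto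
  show ?thesis
  proof
    fix f g assume f: "\<one>\<^bsub>G\<^esub> \<preceq> f" and g: "g \<in> carrier G"
    then show "\<exists>n::nat. g \<preceq> f \<otimes>\<^bsub>G\<^esub> g [^]\<^bsub>G\<^esub> n"
      using uncountable_cones_if_not_conradian [OF f g] assms(3) not_less le_carrier [OF f]
        by (meson m_closed nat_pow_closed)
  next
    fix f g assume f: "f \<preceq> \<one>\<^bsub>G\<^esub>" and g: "g \<in> carrier G"
    then show "\<exists>n::nat. f \<otimes>\<^bsub>G\<^esub> g [^]\<^bsub>G\<^esub> n \<preceq> g"
      using R.uncountable_cones_if_not_conradian [of f g] assms(3) not_less le_carrier [OF f]
        unfolding R R' by (meson m_closed nat_pow_closed)
  qed
qed

context conradian_ordered_group
begin

text \<open>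
  The convex hull of the cyclic subgroup generated by \<open>g\<close>. Conrad's condition makes it a subgroup,
  hence the smallest convex subgroup containing \<open>g\<close>.
\<close>

definition power_hull :: "'a \<Rightarrow> 'a set" where
  "power_hull g = {h. \<exists>(m::int) (n::int). g [^] m \<preceq> h \<and> h \<preceq> g [^] n}"

lemma hull_carrier: "h \<in> power_hull g \<Longrightarrow> h \<in> carrier G"
  by (auto simp: power_hull_def le_carrier)

lemma hull_convex: "x \<in> power_hull g \<Longrightarrow> z \<in> power_hull g \<Longrightarrow> x \<preceq> y \<Longrightarrow> y \<preceq> z \<Longrightarrow> y \<in> power_hull g"
  unfolding power_hull_def using le_trans by blast

lemma pow_in_hull: "g \<in> carrier G \<Longrightarrow> g [^] (k::int) \<in> power_hull g"
  unfolding power_hull_def using le_refl by blast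

lemma hull_self: "g \<in> carrier G \<Longrightarrow> g \<in> power_hull g"
  using pow_in_hull [of g 1] by simp

lemma hull_has_one: "g \<in> carrier G \<Longrightarrow> \<one> \<in> power_hull g"
  using pow_in_hull [of g 0] by simp

text \<open>
  From \<open>h \<le> g\<^sup>n\<close> one gets an element \<open>inv (g\<^sup>n) \<otimes> h\<close> below the identity; Conrad's condition for it
  and for \<open>inv (g\<^sup>n)\<close> yields a power of \<open>g\<close> that \<open>h\<close> carries below the identity.
\<close>

lemma pow_lower_bound_inv:
  assumes g: "g \<in> carrier G" and h: "h \<preceq> g [^] (n::int)"
  shows "\<exists>m::int. g [^] m \<preceq> inv h"
proof -
  have hc: "h \<in> carrier G" using h le_carrier by blast
  have "g [^] (-n) \<otimes> h \<preceq> \<one>"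
    using mult_le_left [OF h, of "g [^] (-n)"] g by (simp add: int_pow_neg)
  then obtain k :: nat where "g [^] (-n) \<otimes> h \<otimes> (g [^] (-n)) [^] k \<preceq> g [^] (-n)"
    using conradian' g by (meson int_pow_closed)
  then have "g [^] (-n) \<otimes> (h \<otimes> g [^] (- n * int k)) \<preceq> g [^] (-n) \<otimes> \<one>"
    using g hc by (simp add: m_assoc int_pow_pow flip: int_pow_int)
  then have "h \<otimes> g [^] (- n * int k) \<preceq> \<one>"
    using g hc mult_le_cancel by (meson int_pow_closed m_closed one_closed)
  then have "inv h \<otimes> (h \<otimes> g [^] (- n * int k)) \<preceq> inv h \<otimes> \<one>"
    using hc by (intro mult_le_left) auto
  then show ?thesis using g hc by (auto simp: m_assoc [symmetric])
qed

lemma pow_upper_bound_inv: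
  assumes g: "g \<in> carrier G" and h: "g [^] (n::int) \<preceq> h"
  shows "\<exists>m::int. inv h \<preceq> g [^] m"
proof -
  have hc: "h \<in> carrier G" using h le_carrier by blast
  have "\<one> \<preceq> g [^] (-n) \<otimes> h"
    using mult_le_left [OF h, of "g [^] (-n)"] g by (simp add: int_pow_neg)
  then obtain k :: nat where "g [^] (-n) \<preceq> g [^] (-n) \<otimes> h \<otimes> (g [^] (-n)) [^] k"
    using conradian g by (meson int_pow_closed)
  then have "g [^] (-n) \<otimes> \<one> \<preceq> g [^] (-n) \<otimes> (h \<otimes> g [^] (- n * int k))"
    using g hc by (simp add: m_assoc int_pow_pow flip: int_pow_int)
  then have "\<one> \<preceq> h \<otimes> g [^] (- n * int k)"
    using g hc mult_le_cancel by (meson int_pow_closed m_closed one_closed)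
  then have "inv h \<otimes> \<one> \<preceq> inv h \<otimes> (h \<otimes> g [^] (- n * int k))"
    using hc by (intro mult_le_left) auto
  then show ?thesis using g hc by (auto simp: m_assoc [symmetric])
qed

lemma hull_inv:
  assumes g: "g \<in> carrier G" and h: "h \<in> power_hull g" shows "inv h \<in> power_hull g"
  using h pow_lower_bound_inv [OF g] pow_upper_bound_inv [OF g]
  unfolding power_hull_def by blast

text \<open>
  A bound on \<open>k\<close> bounds \<open>h \<otimes> k\<close> only by \<open>h \<otimes> g\<^sup>n\<close>, since the ordering is invariant on one side only.
  The inverse of the latter is \<open>inv (g\<^sup>n) \<otimes> inv h\<close>, which the bounds on \<open>inv h\<close> do control.
\<close>

lemma hull_mult:
  assumes g: "g \<in> carrier G" and h: "h \<in> power_hull g" and k: "k \<in> power_hull g"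
    shows "h \<otimes> k \<in> power_hull g"
proof -
  have c: "h \<in> carrier G" "k \<in> carrier G" using h k hull_carrier by auto
  obtain a b :: int where ab: "g [^] a \<preceq> inv h" "inv h \<preceq> g [^] b"
    using hull_inv [OF g h] by (auto simp: power_hull_def)
  obtain m n :: int where mn: "g [^] m \<preceq> k" "k \<preceq> g [^] n"
    using k by (auto simp: power_hull_def)
  have eq: "inv (h \<otimes> g [^] i) = g [^] (- i) \<otimes> inv h" for i :: int
    using c g by (simp add: inv_mult_group int_pow_neg)
  have ii: "inv (inv (h \<otimes> g [^] i)) = h \<otimes> g [^] i" for i :: int
    using c g by simp
  have "g [^] (-n) \<otimes> g [^] a \<preceq> inv (h \<otimes> g [^] n)"
    unfolding eq using ab g by (intro mult_le_left) auto
  then have "g [^] (-n + a) \<preceq> inv (h \<otimes> g [^] n)" using g by (simp only: int_pow_mult)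
  from pow_upper_bound_inv [OF g this] obtain p :: int where p: "h \<otimes> g [^] n \<preceq> g [^] p"
    unfolding ii ..
  have "inv (h \<otimes> g [^] m) \<preceq> g [^] (-m) \<otimes> g [^] b"
    unfolding eq using ab g by (intro mult_le_left) auto
  then have "inv (h \<otimes> g [^] m) \<preceq> g [^] (-m + b)" using g by (simp only: int_pow_mult)
  from pow_lower_bound_inv [OF g this] obtain q :: int where q: "g [^] q \<preceq> h \<otimes> g [^] m"
    unfolding ii ..
  have "g [^] q \<preceq> h \<otimes> k" using le_trans [OF q mult_le_left [OF mn(1) c(1)]] .
  moreover have "h \<otimes> k \<preceq> g [^] p" using le_trans [OF mult_le_left [OF mn(2) c(1)] p] .
  ultimately show ?thesis unfolding power_hull_def by blast
qed

lemma subgroup_power_hull: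
  assumes g: "g \<in> carrier G" shows "subgroup (power_hull g) G"
proof (rule subgroupI)
  show "power_hull g \<subseteq> carrier G" using hull_carrier by blast
  show "power_hull g \<noteq> {}" using hull_self [OF g] by blast
qed (fact hull_inv [OF g], fact hull_mult [OF g])

lemma hull_mono:
  assumes g: "g \<in> carrier G" and h: "h \<in> power_hull g" shows "power_hull h \<subseteq> power_hull g"
proof
  fix x assume "x \<in> power_hull h"
  then obtain m n :: int where mn: "h [^] m \<preceq> x" "x \<preceq> h [^] n" unfolding power_hull_def by blast
  have "h [^] i \<in> power_hull g" for i :: int
    by (rule subgroup_int_pow_closed [OF subgroup_power_hull [OF g] h])
  then show "x \<in> power_hull g" using hull_convex [OF _ _ mn] by simp
qed

lemma hull_inv_eq:
  assumes g: "g \<in> carrier G" shows "power_hull (inv g) = power_hull g"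
proof
  have g': "inv g \<in> carrier G" using g by simp
  have "g \<in> power_hull (inv g)" using hull_inv [OF g' hull_self [OF g']] g by simp
  then show "power_hull g \<subseteq> power_hull (inv g)" by (rule hull_mono [OF g'])
  show "power_hull (inv g) \<subseteq> power_hull g"
    by (rule hull_mono [OF g hull_inv [OF g hull_self [OF g]]])
qed

lemma in_hull_inv_iff:
  assumes "g \<in> carrier G" "h \<in> carrier G" shows "inv h \<in> power_hull g \<longleftrightarrow> h \<in> power_hull g"
  using hull_inv [OF assms(1), of h] hull_inv [OF assms(1), of "inv h"] inv_inv [OF assms(2)]
    by metis

text \<open>
  Passing to inverses changes neither hull, so both elements may be taken above the identity; then
  the smaller one lies in the hull of the larger one.
\<close>

lemma hull_comparable:
  assumes "x \<in> carrier G" "y \<in> carrier G" shows "x \<in> power_hull y \<or> y \<in> power_hull x"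
proof -
  have *: "x \<in> power_hull y \<or> y \<in> power_hull x" if "\<one> \<preceq> x" "\<one> \<preceq> y" for x y
  proof -
    have c: "x \<in> carrier G" "y \<in> carrier G" using that le_carrier(2) by blast+
    show ?thesis
    proof (cases "x \<preceq> y")
      case True
      show ?thesis using hull_convex [OF hull_has_one [OF c(2)] hull_self [OF c(2)] that(1) True]
        by simp
    next
      case False
      then have "y \<preceq> x" using not_le [OF c] less_imp_le by simp
      then show ?thesis using hull_convex [OF hull_has_one [OF c(1)] hull_self [OF c(1)] that(2)]
        by simp
    qed
  qed
  have pos: "\<exists>z \<in> {x, inv x}. \<one> \<preceq> z" if "x \<in> carrier G" for x
    using not_le [OF one_closed that] inv_ge_one [of x] less_imp_le [of x \<one>] by blast
  obtain x' y' where x': "x' \<in> {x, inv x}" "\<one> \<preceq> x'" and y': "y' \<in> {y, inv y}" "\<one> \<preceq> y'"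
    using pos assms by meson
  have "power_hull x' = power_hull x" "power_hull y' = power_hull y"
    using x'(1) y'(1) hull_inv_eq [OF assms(1)] hull_inv_eq [OF assms(2)] by blast+
  moreover have "x' \<in> power_hull y \<longleftrightarrow> x \<in> power_hull y" "y' \<in> power_hull x \<longleftrightarrow> y \<in> power_hull x"
    using x'(1) y'(1) in_hull_inv_iff [OF assms] in_hull_inv_iff [OF assms(2,1)] by blast+
  ultimately show ?thesis using * [OF x'(2) y'(2)] by simp
qed

lemma hull_one: "power_hull \<one> = {\<one>}"
proof (intro Set.set_eqI iffI)
  fix x assume "x \<in> power_hull \<one>"
  then have "\<one> \<preceq> x" "x \<preceq> \<one>" by (auto simp: power_hull_def)
  then show "x \<in> {\<one>}" using le_antisym by simp
qed (simp add: hull_self)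

text \<open>
  If \<open>g\<close> lies outside the hull of \<open>h\<close>, then \<open>h\<close> is negligible compared with \<open>g\<close>: were the sign
  of \<open>g \<otimes> h\<close> or \<open>h \<otimes> g\<close> different from that of \<open>g\<close>, then \<open>g\<close> or its inverse would be trapped between
  the identity and \<open>h\<close> or \<open>inv h\<close>.
\<close>

lemma dominant_factor:
  assumes c: "g \<in> carrier G" "h \<in> carrier G" and n: "g \<notin> power_hull h"
  shows "power_hull (g \<otimes> h) = power_hull g" "power_hull (h \<otimes> g) = power_hull g"
    "g \<otimes> h \<in> P \<longleftrightarrow> g \<in> P" "h \<otimes> g \<in> P \<longleftrightarrow> g \<in> P"
proof -
  have hJ: "h \<in> power_hull g" using hull_comparable c n by blast
  have g_eq: "g \<otimes> h \<otimes> inv h = g" "inv h \<otimes> (h \<otimes> g) = g" using c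
    by (simp_all add: m_assoc) (simp add: m_assoc [symmetric])
  have cc: "g \<otimes> h \<in> carrier G" "h \<otimes> g \<in> carrier G" using c by auto
  have 1: "g \<otimes> h \<in> power_hull g" "h \<otimes> g \<in> power_hull g" using hJ c hull_mult hull_self by auto
  have nh: "g \<otimes> h \<notin> power_hull h" "h \<otimes> g \<notin> power_hull h"
    using hull_mult [OF c(2), of "g \<otimes> h" "inv h"] hull_mult [OF c(2), of "inv h" "h \<otimes> g"]
      hull_inv [OF c(2) hull_self] c(2) n unfolding g_eq by auto
  have h': "h \<in> power_hull (g \<otimes> h)" "h \<in> power_hull (h \<otimes> g)" using hull_comparable c(2) cc nh
    by blast+
  have 2: "g \<in> power_hull (g \<otimes> h)" "g \<in> power_hull (h \<otimes> g)"
    using hull_mult [OF cc(1) hull_self [OF cc(1)] hull_inv [OF cc(1) h'(1)]]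
      hull_mult [OF cc(2) hull_inv [OF cc(2) h'(2)] hull_self [OF cc(2)]] unfolding g_eq by auto
  show "power_hull (g \<otimes> h) = power_hull g" "power_hull (h \<otimes> g) = power_hull g"
    using 1 2 hull_mono c cc by blast+
  have ninv: "inv g \<notin> power_hull h" using n c in_hull_inv_iff by simp
  have g1: "g \<noteq> \<one>" using n hull_has_one c by auto
  note ends = hull_has_one [OF c(2)] hull_self [OF c(2)] hull_inv [OF c(2) hull_self [OF c(2)]]
  have pos: "\<one> \<prec> g \<otimes> h" "\<one> \<prec> h \<otimes> g" if "\<one> \<prec> g"
  proof -
    show "\<one> \<prec> g \<otimes> h"
    proof (rule ccontr)
      assume "\<not> \<one> \<prec> g \<otimes> h"
      then have "g \<otimes> h \<preceq> \<one>" using not_less cc by simp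
      then have "h \<preceq> inv g" using mult_le_left [of "g \<otimes> h" \<one> "inv g"] c
        by (simp add: m_assoc [symmetric])
      then show False
        using hull_convex [OF ends(2) ends(1)] inv_le_one [OF less_imp_le [OF that]] ninv by blast
    qed
    show "\<one> \<prec> h \<otimes> g"
    proof (rule ccontr)
      assume "\<not> \<one> \<prec> h \<otimes> g"
      then have "h \<otimes> g \<preceq> \<one>" using not_less cc by simp
      then have "g \<preceq> inv h" using mult_le_left [of "h \<otimes> g" \<one> "inv h"] c
        by (simp add: m_assoc [symmetric])
      then show False using hull_convex [OF ends(1) ends(3)] less_imp_le [OF that] n by blast
    qed
  qed
  have neg: "\<not> \<one> \<prec> g \<otimes> h" "\<not> \<one> \<prec> h \<otimes> g" if "g \<prec> \<one>"
  proof -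
    show "\<not> \<one> \<prec> g \<otimes> h"
    proof
      assume "\<one> \<prec> g \<otimes> h"
      then have "inv g \<preceq> h" using mult_le_left [of \<one> "g \<otimes> h" "inv g"] c less_imp_le
        by (simp add: m_assoc [symmetric])
      then show False
        using hull_convex [OF ends(1) ends(2)] inv_ge_one [OF less_imp_le [OF that]] ninv by blast
    qed
    show "\<not> \<one> \<prec> h \<otimes> g"
    proof
      assume "\<one> \<prec> h \<otimes> g"
      then have "inv h \<preceq> g" using mult_le_left [of \<one> "h \<otimes> g" "inv h"] c less_imp_le
        by (simp add: m_assoc [symmetric])
      then show False using hull_convex [OF ends(3) ends(1)] less_imp_le [OF that] n by blast
    qed
  qed
  show "g \<otimes> h \<in> P \<longleftrightarrow> g \<in> P" "h \<otimes> g \<in> P \<longleftrightarrow> g \<in> P"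
    unfolding P_iff using pos neg less_linear [OF one_closed c(1)] g1 by blast+
qed

lemma factor_in_hull_of_positive_product:
  assumes "x \<in> P" "y \<in> P" shows "x \<in> power_hull (x \<otimes> y)"
proof -
  have c: "x \<in> carrier G" "x \<otimes> y \<in> carrier G" using assms P_carrier by auto
  have "x \<preceq> x \<otimes> y" using mult_less_left [of \<one> y x] c assms(2) less_imp_le by (simp add: P_iff)
  then show ?thesis
    using hull_convex [OF hull_has_one [OF c(2)] hull_self [OF c(2)]] assms(1) less_imp_le P_iff
      by simp
qed

lemma hull_mult_positive:
  assumes "x \<in> P" "y \<in> P" "power_hull x = power_hull y" shows "power_hull (x \<otimes> y) = power_hull x"
proof -
  have c: "x \<in> carrier G" "y \<in> carrier G" "x \<otimes> y \<in> carrier G" using assms P_carrier by auto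
  have "x \<in> power_hull (x \<otimes> y)" using assms(1,2) by (rule factor_in_hull_of_positive_product)
  moreover have "x \<otimes> y \<in> power_hull x"
    using hull_mult [OF c(1) hull_self [OF c(1)]] hull_self [OF c(2)] assms(3) by simp
  ultimately show ?thesis using hull_mono [OF c(1)] hull_mono [OF c(3)] by blast
qed

definition flip :: "'a set set \<Rightarrow> 'a set" where
  "flip S = {g \<in> carrier G. g \<noteq> \<one> \<and> (g \<in> P \<longleftrightarrow> power_hull g \<notin> S)}"

text \<open>
  In a product the factor with the larger hull decides both the sign and the hull, by dominance;
  two factors with the same hull are reversed together or not at all.
\<close>

lemma flip_cone: "flip S \<in> cones G"
proof -
  have "x \<otimes> y \<in> flip S" if x: "x \<in> flip S" and y: "y \<in> flip S" for x y
  proof -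
    have c: "x \<in> carrier G" "y \<in> carrier G" "x \<noteq> \<one>" "y \<noteq> \<one>"
      and s: "x \<in> P \<longleftrightarrow> power_hull x \<notin> S" "y \<in> P \<longleftrightarrow> power_hull y \<notin> S"
      using x y by (auto simp: flip_def)
    have "power_hull x \<noteq> {\<one>}" "power_hull y \<noteq> {\<one>}" using hull_self c by blast+
    then have ne: "power_hull (x \<otimes> y) = power_hull x \<or> power_hull (x \<otimes> y) = power_hull y \<Longrightarrow> x \<otimes> y \<noteq> \<one>" using hull_one by auto
    have main: "(power_hull (x \<otimes> y) = power_hull x \<and> (x \<otimes> y \<in> P \<longleftrightarrow> x \<in> P)) \<or> (power_hull (x \<otimes> y) = power_hull y \<and> (x \<otimes> y \<in> P \<longleftrightarrow> y \<in> P))"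
    proof -
      consider "x \<notin> power_hull y" | "y \<notin> power_hull x" | "x \<in> power_hull y" "y \<in> power_hull x"
        by blast
      then show ?thesis
      proof cases
        case 1 then show ?thesis using dominant_factor [of x y] c by blast
      next
        case 2 then show ?thesis using dominant_factor [of y x] c by blast
      next
        case 3
        then have eq: "power_hull x = power_hull y" using hull_mono c by blast
        show ?thesis
        proof (cases "x \<in> P")
          case True
          then show ?thesis using hull_mult_positive [of x y] eq s P_mult by auto
        next
          case False
          then have nP: "inv x \<in> P" "inv y \<in> P" using eq s P_total c by auto
          then have "power_hull (inv y \<otimes> inv x) = power_hull (inv y)" "inv y \<otimes> inv x \<in> P"
            using hull_mult_positive [of "inv y" "inv x"] eq c hull_inv_eq P_mult by auto
          moreover have "inv y \<otimes> inv x = inv (x \<otimes> y)" using c by (simp add: inv_mult_group)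
          ultimately show ?thesis
            using c hull_inv_eq [of "x \<otimes> y"] hull_inv_eq [of y] False P_inv [of "x \<otimes> y"] eq by auto
        qed
      qed
    qed
    then show ?thesis using ne s c by (auto simp: flip_def)
  qed
  moreover have "x \<in> flip S \<or> inv x \<in> flip S" if "x \<in> carrier G" "x \<noteq> \<one>" for x
    using that P_total [OF that] P_inv [of x] P_inv [of "inv x"] hull_inv_eq [of x] inv_eq_1_iff [of x]
    by (auto simp: flip_def)
  ultimately show ?thesis
    by (auto simp: cones_def positive_cone_def) (auto simp: flip_def)
qed

text \<open>
  By comparability these hulls form a chain; they are the convex subgroups generated by a single
  nontrivial element.
\<close>

definition levels :: "'a set set" where
  "levels = power_hull ` (carrier G - {\<one>})"

text \<open>
  Since \<open>S\<close> can be read off from the flipped ordering, there are at least as many orderings as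
  sets of levels.
\<close>

lemma finite_levels:
  assumes "countable (cones G)" shows "finite levels"
proof (rule ccontr)
  assume inf: "infinite levels"
  have "inj_on flip (Pow levels)"
  proof (rule inj_onI)
    fix S T assume ST: "S \<in> Pow levels" "T \<in> Pow levels" and eq: "flip S = flip T"
    have "power_hull g \<in> S \<longleftrightarrow> power_hull g \<in> T" if "g \<in> carrier G" "g \<noteq> \<one>" for g
    proof -
      have "g \<in> flip S \<longleftrightarrow> g \<in> flip T" using eq by simp
      then show ?thesis using that by (auto simp: flip_def)
    qed
    then show "S = T" using ST unfolding levels_def by blast
  qed
  moreover have "flip ` Pow levels \<subseteq> cones G" using flip_cone by blast
  ultimately have "countable (Pow levels)"
    using countable_image_inj_on [OF countable_subset [OF _ assms]] by blast
  then show False using uncountable_Pow [OF inf] by blast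
qed

end

section \<open>Archimedean orderings and the largest proper convex subgroup\<close>

lemma (in group) conj_int_pow:
  assumes "g \<in> carrier G" "c \<in> carrier G"
  shows "(g \<otimes> c \<otimes> inv g) [^] (n::int) = g \<otimes> c [^] n \<otimes> inv g"
proof -
  have "g \<otimes> (x \<otimes> y) \<otimes> inv g = (g \<otimes> x \<otimes> inv g) \<otimes> (g \<otimes> y \<otimes> inv g)"
    if "x \<in> carrier G" "y \<in> carrier G" for x y
  proof -
    have "inv g \<otimes> (g \<otimes> (y \<otimes> inv g)) = y \<otimes> inv g"
      using assms(1) that by (simp add: m_assoc [symmetric])
    then show ?thesis using assms(1) that by (simp add: m_assoc)
  qed
  then interpret group_hom G G "\<lambda>x. g \<otimes> x \<otimes> inv g"
    using assms(1) by unfold_locales (auto simp: hom_def)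
  show ?thesis using hom_int_pow [OF assms(2)] by simp
qed

lemma (in group) conj_mult_right:
  assumes "g \<in> carrier G" "c \<in> carrier G"
  shows "(g \<otimes> c \<otimes> inv g) [^] (n::int) \<otimes> g = g \<otimes> c [^] n"
  unfolding conj_int_pow [OF assms] using assms by (simp add: m_assoc)

context left_ordered_group
begin

lemma pow_mono:
  assumes w: "w \<in> P" and mn: "m < (n::int)" shows "w [^] m \<prec> w [^] n"
proof -
  have wc: "w \<in> carrier G" using w P_carrier by blast
  have "w [^] Suc k \<in> P" for k :: nat
    using w by (induction k) (auto simp: P_mult P_carrier)
  then have "w [^] (int (Suc (nat (n - m - 1)))) \<in> P" unfolding int_pow_int .
  then have "w [^] (n - m) \<in> P" using mn by simp
  then have "w [^] m \<otimes> \<one> \<prec> w [^] m \<otimes> w [^] (n - m)"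
    using wc unfolding P_iff by (intro mult_less_left) auto
  then show ?thesis using wc by (simp add: int_pow_mult [symmetric])
qed

text \<open>
  Hoelder's theorem, for orderings that are invariant only on the left. The Archimedean property
  first forces invariance under conjugation: if \<open>x\<close> is positive and its conjugate by \<open>h\<close> negative,
  then all positive powers of the conjugate stay below the identity, which bounds the powers of \<open>x\<close> or
  those of the inverse of the conjugate. Next, trapping \<open>x\<close> and \<open>y\<close> between consecutive powers of a
  positive \<open>w\<close>
    shows that their commutator is less than \<open>w\<^sup>2\<close>. A positive commutator \<open>z\<close> cannot exist:
  if something positive lies below \<open>z\<close>, then \<open>z\<close> is a product of two positive elements,
    and the square
  of the smaller one is below \<open>z\<close>; otherwise \<open>z\<close> is the least positive element
    and generates the group.
\<close>

lemma archimedean_imp_abelian: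
  assumes arch: "\<And>x y. x \<in> P \<Longrightarrow> y \<in> carrier G \<Longrightarrow> \<exists>(m::int) (n::int). x [^] m \<preceq> y \<and> y \<preceq> x [^] n"
    and xy: "x \<in> carrier G" "y \<in> carrier G"
  shows "x \<otimes> y = y \<otimes> x"
proof -
  have bound: "\<exists>n>0. y \<prec> x [^] (n::int)" if x: "x \<in> P" and y: "y \<in> carrier G" for x y
  proof -
    obtain n :: int where n: "y \<preceq> x [^] n" using arch [OF x y] by blast
    also have "x [^] n \<prec> x [^] (\<bar>n\<bar> + 1)" using x by (rule pow_mono) simp
    finally show ?thesis by (intro exI [of _ "\<bar>n\<bar> + 1"]) simp
  qed
  have pow_pos: "\<one> \<prec> x [^] n" if "x \<in> P" "n > 0" for x and n :: int
    using pow_mono [OF that] by simp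
  have conj: "h \<otimes> x \<otimes> inv h \<in> P" if x: "x \<in> P" and h: "h \<in> carrier G" for x h
  proof (rule ccontr)
    assume neg: "h \<otimes> x \<otimes> inv h \<notin> P"
    have xc: "x \<in> carrier G" using x P_carrier by blast
    have k1: "h \<otimes> x \<otimes> inv h \<noteq> \<one>"
    proof
      assume "h \<otimes> x \<otimes> inv h = \<one>"
      then have "h \<otimes> x = h" using xc h inv_solve_right' [of \<one> "h \<otimes> x" h] by simp
      then show False using xc h x one_notin_P by simp
    qed
    then have kP: "inv (h \<otimes> x \<otimes> inv h) \<in> P" using P_total [of "h \<otimes> x \<otimes> inv h"] neg k1 xc h by simp
    have k_eq: "inv (h \<otimes> x \<otimes> inv h) [^] n = h \<otimes> x [^] (-n) \<otimes> inv h" for n :: int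
    proof -
      have "inv (h \<otimes> x \<otimes> inv h) [^] n = (h \<otimes> x \<otimes> inv h) [^] (-n)"
        using xc h by (simp only: int_pow_inv int_pow_neg m_closed inv_closed)
      also have "\<dots> = h \<otimes> x [^] (-n) \<otimes> inv h" by (rule conj_int_pow [OF h xc])
      finally show ?thesis .
    qed
    consider "\<one> \<preceq> h" | "h \<preceq> \<one>" using not_le [OF one_closed h] less_imp_le by blast
    then show False
    proof cases
      case 1
      obtain n :: int where n: "n > 0" "h \<prec> inv (h \<otimes> x \<otimes> inv h) [^] n" using bound [OF kP h]
        by blast
      then have "h \<otimes> \<one> \<prec> h \<otimes> (x [^] (-n) \<otimes> inv h)" unfolding k_eq using xc h by (simp add: m_assoc)
      then have "\<one> \<prec> x [^] (-n) \<otimes> inv h" using mult_less_cancel xc h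
        by (meson int_pow_closed inv_closed m_closed one_closed)
      also have "x [^] (-n) \<otimes> inv h \<preceq> x [^] (-n) \<otimes> \<one>"
        using inv_le_one [OF 1] xc by (intro mult_le_left) auto
      also have "\<dots> \<prec> \<one>" using pow_mono [OF x, of "-n" 0] n xc by simp
      finally show False using less_irrefl by blast
    next
      case 2
      obtain n :: int where n: "n > 0" "inv h \<prec> x [^] n" using bound [OF x] h by blast
      have "x [^] n \<otimes> \<one> \<preceq> x [^] n \<otimes> inv h" using inv_ge_one [OF 2] xc by (intro mult_le_left) auto
      with n have "inv h \<prec> x [^] n \<otimes> inv h" using less_le_trans xc by simp
      then have "h \<otimes> inv h \<prec> h \<otimes> (x [^] n \<otimes> inv h)" using h by (rule mult_less_left)
      also have "\<dots> = inv (h \<otimes> x \<otimes> inv h) [^] (-n)" unfolding k_eq using h xc by (simp add: m_assoc)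
      also have "\<dots> \<prec> \<one>" using pow_mono [OF kP, of "-n" 0] n by simp
      finally show False using h less_irrefl by simp
    qed
  qed
  have mult_right: "x \<otimes> a \<prec> y \<otimes> a" if "x \<prec> y" "a \<in> carrier G" for x y a
  proof -
    have c: "x \<in> carrier G" "y \<in> carrier G" "inv x \<otimes> y \<in> P" using that by (auto simp: less_def)
    have "inv a \<otimes> (inv x \<otimes> y) \<otimes> inv (inv a) \<in> P" using conj [OF c(3), of "inv a"] that(2) by simp
    then show ?thesis using c that by (simp add: less_def inv_mult_group m_assoc)
  qed
  have mult_right_le: "x \<otimes> a \<preceq> y \<otimes> a" if "x \<preceq> y" "a \<in> carrier G" for x y a
    using that mult_right [of x y a] by (auto simp: less_eq_def)
  have floor: "\<exists>m::int. w [^] m \<preceq> x \<and> x \<prec> w [^] (m + 1)" if w: "w \<in> P"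
    and x: "x \<in> carrier G" for w x
  proof -
    have wc: "w \<in> carrier G" using w P_carrier by blast
    obtain a b :: int where a: "w [^] a \<preceq> x" and b: "x \<preceq> w [^] b" using arch [OF w x] by blast
    let ?Q = "\<lambda>k. x \<prec> w [^] (a + int k + 1)"
    have "w [^] b \<prec> w [^] (a + int (nat (b - a)) + 1)" using w by (rule pow_mono) simp
    then have ex: "\<exists>k. ?Q k" using le_less_trans [OF b] by blast
    define k where "k = (LEAST k. ?Q k)"
    have k: "?Q k" unfolding k_def by (rule LeastI_ex [OF ex])
    have "w [^] (a + int k) \<preceq> x"
    proof (cases k)
      case 0 then show ?thesis using a by simp
    next
      case (Suc j)
      then have "\<not> ?Q j" using not_less_Least [of j ?Q] unfolding k_def by simp
      then have "w [^] (a + int j + 1) \<preceq> x" using not_less x wc by simp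
      then show ?thesis using Suc by (simp add: algebra_simps)
    qed
    then show ?thesis using k by blast
  qed
  have comm_small: "inv (y \<otimes> x) \<otimes> (x \<otimes> y) \<prec> w \<otimes> w"
    if c: "x \<in> carrier G" "y \<in> carrier G" and w: "w \<in> P" for x y w
  proof -
    have wc: "w \<in> carrier G" using w P_carrier by blast
    obtain m :: int where m: "w [^] m \<preceq> x" "x \<prec> w [^] (m + 1)" using floor [OF w c(1)] by blast
    obtain n :: int where n: "w [^] n \<preceq> y" "y \<prec> w [^] (n + 1)" using floor [OF w c(2)] by blast
    have "x \<otimes> y \<prec> w [^] (m + 1) \<otimes> y" using mult_right [OF m(2) c(2)] .
    also have "\<dots> \<prec> w [^] (m + 1) \<otimes> w [^] (n + 1)" using n(2) wc by (intro mult_less_left) auto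
    also have "\<dots> = w [^] n \<otimes> w [^] m \<otimes> (w \<otimes> w)"
    proof -
      have "w \<otimes> w = w [^] (2::int)" using wc int_pow_mult [of w 1 1] by simp
      moreover have "(m + 1) + (n + 1) = n + m + 2" by simp
      ultimately show ?thesis using wc by (simp only: int_pow_mult [symmetric])
    qed
    also have "\<dots> \<preceq> w [^] n \<otimes> x \<otimes> (w \<otimes> w)"
      using m(1) wc by (intro mult_right_le mult_le_left) auto
    also have "\<dots> \<preceq> y \<otimes> x \<otimes> (w \<otimes> w)"
      using n(1) wc c by (intro mult_right_le) auto
    finally have "inv (y \<otimes> x) \<otimes> (x \<otimes> y) \<prec> inv (y \<otimes> x) \<otimes> (y \<otimes> x \<otimes> (w \<otimes> w))"
      using c by (intro mult_less_left) auto
    also have "inv (y \<otimes> x) \<otimes> (y \<otimes> x \<otimes> (w \<otimes> w)) = w \<otimes> w"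
      using m_assoc [of "inv (y \<otimes> x)" "y \<otimes> x" "w \<otimes> w"] c wc by simp
    finally show ?thesis .
  qed
  have not_pos: "inv (y \<otimes> x) \<otimes> (x \<otimes> y) \<notin> P" if c: "x \<in> carrier G" "y \<in> carrier G" for x y
  proof
    define z where "z = inv (y \<otimes> x) \<otimes> (x \<otimes> y)"
    assume "inv (y \<otimes> x) \<otimes> (x \<otimes> y) \<in> P"
    then have zP: "z \<in> P" by (simp add: z_def)
    then have zc: "z \<in> carrier G" using P_carrier by blast
    have small: "z \<prec> w \<otimes> w" if "w \<in> P" for w using comm_small [OF c that] by (simp add: z_def)
    show False
    proof (cases "\<exists>w\<in>P. w \<prec> z")
      case True
      then obtain w where w: "w \<in> P" "w \<prec> z" by blast
      have wc: "w \<in> carrier G" using w P_carrier by blast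
      \<comment> \<open>The commutator bound makes \<open>v\<close> the smaller one of the two factors in \<open>z = w \<otimes> v\<close>.\<close>
      define v where "v = inv w \<otimes> z"
      have vP: "v \<in> P" using w by (simp add: v_def less_def)
      have z_eq: "z = w \<otimes> v" using wc zc by (simp add: v_def m_assoc [symmetric])
      have "w \<otimes> v \<prec> w \<otimes> w" using small [OF w(1)] z_eq by simp
      then have "v \<prec> w" using mult_less_cancel wc vP P_carrier by blast
      then have "v \<otimes> v \<prec> z" using mult_right vP P_carrier z_eq by simp
      then show False using small [OF vP] less_trans less_irrefl by blast
    next
      case False
      have power: "\<exists>m::int. u = z [^] m" if u: "u \<in> carrier G" for u
      proof -
        obtain m :: int where m: "z [^] m \<preceq> u" "u \<prec> z [^] (m + 1)" using floor [OF zP u] by blast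
        define r where "r = inv (z [^] m) \<otimes> u"
        have rc: "r \<in> carrier G" using u zc by (simp add: r_def)
        have u_eq: "u = z [^] m \<otimes> r" using u zc by (simp add: r_def m_assoc [symmetric])
        have "z [^] m \<otimes> r \<prec> z [^] m \<otimes> z" using m(2) zc u_eq by (simp add: int_pow_mult)
        then have "r \<prec> z" using mult_less_cancel zc rc by (meson int_pow_closed)
        moreover have "z [^] m \<otimes> \<one> \<preceq> z [^] m \<otimes> r" using m(1) zc u_eq by simp
        then have "\<one> \<preceq> r" using mult_le_cancel zc rc by (meson int_pow_closed one_closed)
        ultimately have "r = \<one>" using False by (auto simp: less_eq_def P_iff)
        then show ?thesis using u_eq zc by auto
      qed
      obtain m n :: int where "x = z [^] m" "y = z [^] n" using power c by meson
      then have "x \<otimes> y = y \<otimes> x" using zc by (simp add: int_pow_mult [symmetric] add.commute)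
      then have "z = \<one>" using c by (simp add: z_def)
      then show False using zP one_notin_P by simp
    qed
  qed
  have "inv (inv (y \<otimes> x) \<otimes> (x \<otimes> y)) = inv (x \<otimes> y) \<otimes> (y \<otimes> x)" using xy
    by (simp add: inv_mult_group m_assoc)
  then have "inv (y \<otimes> x) \<otimes> (x \<otimes> y) = \<one>"
    using not_pos [OF xy] not_pos [OF xy(2,1)] P_total [of "inv (y \<otimes> x) \<otimes> (x \<otimes> y)"] xy by auto
  then show ?thesis using xy inv_solve_left' [of \<one> "y \<otimes> x" "x \<otimes> y"] by simp
qed

end

context conradian_ordered_group
begin

text \<open>
  The elements whose powers leave some element of the group unbounded. If a nontrivial group has
  other elements as well, this is its largest proper convex subgroup.
\<close>

definition small_part :: "'a set" where
  "small_part = {h \<in> carrier G. power_hull h \<noteq> carrier G}"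

lemma exists_cofinal:
  assumes "finite levels" "carrier G \<noteq> {\<one>}"
  shows "\<exists>g\<in>carrier G. g \<notin> small_part"
proof -
  have "levels \<noteq> {}" using assms(2) one_closed by (auto simp: levels_def)
  then obtain M
    where M: "M \<in> levels" "\<And>N. N \<in> levels \<Longrightarrow> M \<subseteq> N \<Longrightarrow> N = M"
    using finite_has_maximal [OF assms(1)] by metis
  then obtain g where g: "g \<in> carrier G" "g \<noteq> \<one>" "M = power_hull g" by (auto simp: levels_def)
  have "h \<in> power_hull g" if h: "h \<in> carrier G" for h
  proof (rule ccontr)
    assume n: "h \<notin> power_hull g"
    then have gh: "g \<in> power_hull h" using hull_comparable [OF h g(1)] by blast
    have "h \<noteq> \<one>" using n hull_has_one [OF g(1)] by blast
    then have "power_hull h \<in> levels" using h by (auto simp: levels_def)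
    then have "power_hull h = M" using M(2) hull_mono [OF h gh] g(3) by blast
    then show False using n g(3) hull_self [OF h] by blast
  qed
  then have "power_hull g = carrier G" using hull_carrier by blast
  then show ?thesis using g(1) by (auto simp: small_part_def)
qed

lemma not_in_hull_of_small:
  assumes "g \<in> carrier G" "g \<notin> small_part" "c \<in> small_part" shows "g \<notin> power_hull c"
proof
  assume "g \<in> power_hull c"
  moreover have c: "c \<in> carrier G" using assms(3) by (simp add: small_part_def)
  ultimately have "power_hull g \<subseteq> power_hull c" using hull_mono by blast
  moreover have "power_hull c \<subseteq> carrier G" using hull_carrier by blast
  moreover have "power_hull g = carrier G" using assms by (simp add: small_part_def)
  ultimately show False using assms(3) by (simp add: small_part_def)
qed

lemma hull_of_small_part:
  assumes "h \<in> carrier G" "g \<in> power_hull h" "h \<in> small_part" shows "g \<in> small_part"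
  using not_in_hull_of_small [OF _ _ assms(3), of g] hull_carrier [OF assms(2)] assms(2) by blast

lemma mult_notin_small_part:
  assumes "x \<in> P" "x \<notin> small_part" "y \<in> P" shows "x \<otimes> y \<notin> small_part"
  using hull_of_small_part [OF _ factor_in_hull_of_positive_product [OF assms(1,3)]] assms P_carrier by auto

lemma subgroup_small_part:
  assumes "carrier G \<noteq> {\<one>}" shows "subgroup small_part G"
proof (rule subgroupI)
  show "small_part \<subseteq> carrier G" by (auto simp: small_part_def)
  have "\<one> \<in> small_part" using assms hull_one by (auto simp: small_part_def)
  then show "small_part \<noteq> {}" by blast
next
  fix a assume "a \<in> small_part"
  then show "inv a \<in> small_part" using hull_inv_eq by (simp add: small_part_def)
next
  fix a b assume ab: "a \<in> small_part" "b \<in> small_part"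
  then have c: "a \<in> carrier G" "b \<in> carrier G" by (auto simp: small_part_def)
  show "a \<otimes> b \<in> small_part"
  proof (cases "a \<in> power_hull b")
    case True
    then have "a \<otimes> b \<in> power_hull b" using hull_mult hull_self c by simp
    then show ?thesis using hull_of_small_part c ab by blast
  next
    case False
    then have "b \<in> power_hull a" using hull_comparable [OF c] by blast
    then have "a \<otimes> b \<in> power_hull a" using hull_mult hull_self c by simp
    then show ?thesis using hull_of_small_part c ab by blast
  qed
qed

text \<open>
  Suppose the conjugate \<open>k\<close> of a small \<open>c\<close> by \<open>g\<close> were not small. Its powers then carry the identity
  past every bound, and carry \<open>g\<close> at least as far if \<open>g \<ge> \<one>\<close>. But they carry \<open>g\<close> to the elements
  \<open>g \<otimes> c\<^sup>n\<close>, which remain below \<open>g \<otimes> d\<close> for every positive \<open>d\<close> that is not small. For \<open>g \<le> \<one>\<close> the same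
  happens in the downward direction.
\<close>

lemma normal_small_part:
  assumes nt: "carrier G \<noteq> {\<one>}" shows "small_part \<lhd> G"
proof -
  have "g \<otimes> c \<otimes> inv g \<in> small_part" if g: "g \<in> carrier G" and c: "c \<in> small_part" for g c
  proof (rule ccontr)
    define k where "k = g \<otimes> c \<otimes> inv g"
    assume "g \<otimes> c \<otimes> inv g \<notin> small_part"
    then have kn: "k \<notin> small_part" by (simp add: k_def)
    have cc: "c \<in> carrier G" using c by (simp add: small_part_def)
    have kc: "k \<in> carrier G" using g cc by (simp add: k_def)
    have hull_k: "power_hull k = carrier G" using kn kc by (simp add: small_part_def)
    have kg: "k [^] n \<otimes> g = g \<otimes> c [^] n" for n :: int
      unfolding k_def by (rule conj_mult_right [OF g cc])
    have "\<exists>d \<in> {k, inv k}. \<one> \<preceq> d"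
      using not_le [OF one_closed kc] inv_ge_one [of k] less_imp_le [of k \<one>] by blast
    then obtain d where d: "d \<in> {k, inv k}" "\<one> \<preceq> d" by blast
    have dc: "d \<in> carrier G" using d kc by auto
    have dn: "d \<notin> small_part" using d kn kc hull_inv_eq [OF kc] by (auto simp: small_part_def)
    consider "\<one> \<preceq> g" | "g \<preceq> \<one>" using not_le [OF one_closed g] less_imp_le by blast
    then show False
    proof cases
      case 1
      have "g \<otimes> d \<in> power_hull k" using hull_k g dc by simp
      then obtain n :: int where n: "g \<otimes> d \<preceq> k [^] n" unfolding power_hull_def by blast
      also have "k [^] n \<otimes> \<one> \<preceq> k [^] n \<otimes> g" using 1 kc by (intro mult_le_left) auto
      then have "k [^] n \<preceq> g \<otimes> c [^] n" using kc kg by simp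
      finally have "d \<preceq> c [^] n" using mult_le_cancel g dc cc by (meson int_pow_closed)
      then have "d \<in> power_hull c"
        using hull_convex [OF hull_has_one [OF cc] pow_in_hull [OF cc] d(2)] by blast
      then show False using not_in_hull_of_small [OF dc dn c] by blast
    next
      case 2
      have "g \<otimes> inv d \<in> power_hull k" using hull_k g dc by simp
      then obtain n :: int where n: "k [^] n \<preceq> g \<otimes> inv d" unfolding power_hull_def by blast
      have "k [^] n \<otimes> g \<preceq> k [^] n \<otimes> \<one>" using 2 kc by (intro mult_le_left) auto
      then have "g \<otimes> c [^] n \<preceq> k [^] n" using kc kg by simp
      also note n
      finally have "c [^] n \<preceq> inv d" using mult_le_cancel g dc cc
        by (meson int_pow_closed inv_closed)
      then have "inv d \<in> power_hull c"
        using hull_convex [OF pow_in_hull [OF cc] hull_has_one [OF cc] _ inv_le_one [OF d(2)]]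
          by blast
      then have "d \<in> power_hull c" using in_hull_inv_iff [OF cc dc] by blast
      then show False using not_in_hull_of_small [OF dc dn c] by blast
    qed
  qed
  then show ?thesis using subgroup_small_part [OF nt] by (simp add: normal_inv_iff)
qed

lemma small_part_root:
  assumes g: "g \<in> carrier G" and n: "n > 0" and gn: "g [^] (n::nat) \<in> small_part"
  shows "g \<in> small_part"
proof -
  have gc: "g [^] n \<in> carrier G" using g by simp
  have pos: "x \<in> power_hull (x [^] n)" if x: "\<one> \<preceq> x" for x
  proof -
    have xc: "x \<in> carrier G" using x le_carrier(2) by blast
    obtain k where k: "n = Suc k" using n gr0_implies_Suc by blast
    have "x \<otimes> \<one> \<preceq> x \<otimes> x [^] k" using pow_ge_one [OF x] xc by (intro mult_le_left) auto
    then have "x \<preceq> x [^] n" using xc nat_pow_Suc2 [OF xc, of k] k by simp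
    then show ?thesis using hull_convex [OF hull_has_one hull_self x] xc by simp
  qed
  have "g \<in> power_hull (g [^] n)"
  proof (cases "\<one> \<preceq> g")
    case False
    then have "\<one> \<preceq> inv g" using not_le [OF one_closed g] inv_ge_one [of g] less_imp_le [of g \<one>]
      by blast
    then have "inv g \<in> power_hull (inv g [^] n)" by (rule pos)
    then have "inv g \<in> power_hull (g [^] n)" using g gc by (simp add: nat_pow_inv hull_inv_eq)
    then show ?thesis using in_hull_inv_iff g gc by simp
  qed (rule pos)
  then show ?thesis using hull_of_small_part gn gc by blast
qed

text \<open>
  The ordering descends to the quotient because signs of elements outside the small part do not
  change within a coset, and there it is Archimedean because these elements have cofinal powers.
\<close>

lemma abelian_mod_small_part:
  assumes nt: "carrier G \<noteq> {\<one>}" shows "comm_group (G Mod small_part)"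
proof -
  interpret N: normal small_part G by (rule normal_small_part [OF nt])
  have sub: "subgroup small_part G" by (rule subgroup_small_part [OF nt])
  let ?H = "G Mod small_part"
  let ?p = "\<lambda>x. small_part #> x"
  interpret H: group ?H by (rule N.factorgroup_is_group)
  interpret p: group_hom G ?H ?p
    using N.r_coset_hom_Mod by unfold_locales
  have surj: "carrier ?H = ?p ` carrier G" by (simp add: carrier_FactGroup)
  have p_one: "?p x = \<one>\<^bsub>?H\<^esub> \<longleftrightarrow> x \<in> small_part" if "x \<in> carrier G" for x
    using coset_join1 [OF _ that sub] coset_join2 [OF that sub] N.subset by auto
  let ?Q = "?p ` (P - small_part)"
  have q1: "?Q \<subseteq> carrier ?H" using surj P_carrier by auto
  have q2: "\<one>\<^bsub>?H\<^esub> \<notin> ?Q"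
  proof
    assume "\<one>\<^bsub>?H\<^esub> \<in> ?Q"
    then obtain x where "x \<in> P" "x \<notin> small_part" "?p x = \<one>\<^bsub>?H\<^esub>" by force
    then show False using p_one [of x] P_carrier by blast
  qed
  have q3: "a \<otimes>\<^bsub>?H\<^esub> b \<in> ?Q" if "a \<in> ?Q" "b \<in> ?Q" for a b
  proof -
    obtain x where x: "x \<in> P" "x \<notin> small_part" "a = ?p x" using \<open>a \<in> ?Q\<close> by blast
    obtain y where y: "y \<in> P" "y \<notin> small_part" "b = ?p y" using \<open>b \<in> ?Q\<close> by blast
    have c: "x \<in> carrier G" "y \<in> carrier G" "x \<otimes> y \<in> carrier G" using x y P_carrier by auto
    have "x \<otimes> y \<notin> small_part" using mult_notin_small_part x y by blast
    moreover have "x \<otimes> y \<in> P" using P_mult x y by blast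
    moreover have "a \<otimes>\<^bsub>?H\<^esub> b = ?p (x \<otimes> y)" using p.hom_mult [OF c(1,2)] x y by simp
    ultimately show ?thesis by blast
  qed
  have q4: "a \<in> ?Q \<or> inv\<^bsub>?H\<^esub> a \<in> ?Q" if "a \<in> carrier ?H" "a \<noteq> \<one>\<^bsub>?H\<^esub>" for a
  proof -
    obtain x where x: "x \<in> carrier G" "a = ?p x" using \<open>a \<in> carrier ?H\<close> surj by blast
    have xn: "x \<notin> small_part" using that(2) p_one x by blast
    then have "inv x \<notin> small_part" using N.m_inv_closed [of "inv x"] x by auto
    moreover have "x \<noteq> \<one>" using xn N.one_closed by blast
    moreover have "inv\<^bsub>?H\<^esub> a = ?p (inv x)" using p.hom_inv x by simp
    ultimately show ?thesis using P_total [of x] x xn by blast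
  qed
  have "positive_cone ?H ?Q" unfolding positive_cone_def by (intro conjI ballI impI q1 q2 q3 q4)
  then interpret Q: left_ordered_group ?H ?Q
    by (intro left_ordered_groupI H.group_axioms) (simp add: cones_def)
  have p_mono: "Q.less_eq (?p x) (?p y)" if "x \<preceq> y" for x y
  proof -
    have c: "x \<in> carrier G" "y \<in> carrier G" using that le_carrier by blast+
    have eq: "inv\<^bsub>?H\<^esub> (?p x) \<otimes>\<^bsub>?H\<^esub> ?p y = ?p (inv x \<otimes> y)"
      using p.hom_mult [of "inv x" y] p.hom_inv [of x] c by (simp only: inv_closed)
    consider "x = y" | "inv x \<otimes> y \<in> P" "inv x \<otimes> y \<notin> small_part" | "inv x \<otimes> y \<in> small_part"
      using \<open>x \<preceq> y\<close> by (auto simp: less_eq_def less_def)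
    then show ?thesis
    proof cases
      case 3
      have "inv\<^bsub>?H\<^esub> (?p x) \<otimes>\<^bsub>?H\<^esub> ?p y = \<one>\<^bsub>?H\<^esub>"
        unfolding eq using 3 p_one [of "inv x \<otimes> y"] c by blast
      then have "?p x = ?p y"
        using H.inv_solve_left' [of "\<one>\<^bsub>?H\<^esub>" "?p x" "?p y"] c p.hom_closed H.r_one H.one_closed
          by metis
      then show ?thesis using c p.hom_closed by (simp add: Q.le_refl)
    next
      case 2
      then have "inv\<^bsub>?H\<^esub> (?p x) \<otimes>\<^bsub>?H\<^esub> ?p y \<in> ?Q" unfolding eq by blast
      then show ?thesis using c p.hom_closed by (simp add: Q.less_eq_def Q.less_def)
    qed (use c p.hom_closed in \<open>simp add: Q.le_refl\<close>)
  qed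
  have "\<exists>(m::int) (n::int). Q.less_eq (a [^]\<^bsub>?H\<^esub> m) b \<and> Q.less_eq b (a [^]\<^bsub>?H\<^esub> n)"
    if a: "a \<in> ?Q" and b: "b \<in> carrier ?H" for a b
  proof -
    obtain x where x: "x \<in> P" "x \<notin> small_part" "a = ?p x" using a by blast
    obtain y where y: "y \<in> carrier G" "b = ?p y" using b surj by blast
    have xc: "x \<in> carrier G" using x P_carrier by blast
    have "y \<in> power_hull x" using x(2) xc y(1) unfolding small_part_def by blast
    then obtain m n :: int where mn: "x [^] m \<preceq> y" "y \<preceq> x [^] n" unfolding power_hull_def by blast
    have pw: "?p (x [^] i) = a [^]\<^bsub>?H\<^esub> i" for i :: int using p.hom_int_pow [OF xc] x(3) by simp
    show ?thesis
    proof (intro exI conjI)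
      show "Q.less_eq (a [^]\<^bsub>?H\<^esub> m) b" using p_mono [OF mn(1)] unfolding pw y(2) .
      show "Q.less_eq b (a [^]\<^bsub>?H\<^esub> n)" using p_mono [OF mn(2)] unfolding pw y(2) .
    qed
  qed
  then show ?thesis
    by (intro H.group_comm_groupI Q.archimedean_imp_abelian)
qed

end

section \<open>Torsion-free abelian groups of rank at least two\<close>

context comm_group
begin

text \<open>
  A maximal semigroup \<open>M\<close> containing \<open>S\<close> but not the identity is a cone. If \<open>x\<close> is missing from \<open>M\<close>,
  then adjoining it produces the identity, so some positive power of \<open>inv x\<close> lies in \<open>M\<close>. If \<open>inv x\<close>
  is missing as well, a positive power of \<open>x\<close> lies in \<open>M\<close>, and suitable powers of these two elements
  multiply to the identity.
\<close>

lemma extend_to_cone: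
  assumes torsion_free: "\<And>x n. x \<in> carrier G \<Longrightarrow> n > 0 \<Longrightarrow> x [^] (n::nat) = \<one> \<Longrightarrow> x = \<one>"
    and S: "S \<subseteq> carrier G" "\<one> \<notin> S" "\<And>x y. x \<in> S \<Longrightarrow> y \<in> S \<Longrightarrow> x \<otimes> y \<in> S"
  shows "\<exists>P\<in>cones G. S \<subseteq> P"
proof -
  define F where "F = {T. S \<subseteq> T \<and> T \<subseteq> carrier G \<and> \<one> \<notin> T \<and> (\<forall>x\<in>T. \<forall>y\<in>T. x \<otimes> y \<in> T)}"
  have "\<exists>M\<in>F. \<forall>X\<in>F. M \<subseteq> X \<longrightarrow> X = M"
  proof (rule subset_Zorn_nonempty)
    show "F \<noteq> {}" using S by (auto simp: F_def)
    fix K assume K: "K \<noteq> {}" "subset.chain F K"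
    have KF: "T \<in> F" if "T \<in> K" for T using K(2) that by (auto simp: subset.chain_def)
    have "x \<otimes> y \<in> \<Union>K" if "x \<in> \<Union>K" "y \<in> \<Union>K" for x y
    proof -
      obtain A B where A: "A \<in> K" "x \<in> A" and B: "B \<in> K" "y \<in> B"
        using \<open>x \<in> \<Union>K\<close> \<open>y \<in> \<Union>K\<close> by blast
      have "A \<subseteq> B \<or> B \<subseteq> A" using K(2) A B by (auto simp: subset_chain_def)
      then obtain T where T: "T \<in> K" "x \<in> T" "y \<in> T" using A B by blast
      then have "x \<otimes> y \<in> T" using KF [of T] by (simp add: F_def)
      then show ?thesis using T by blast
    qed
    moreover have "S \<subseteq> \<Union>K"
    proof -
      obtain T where T: "T \<in> K" using K(1) by blast
      then have "S \<subseteq> T" using KF [OF T] by (simp add: F_def)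
      then show ?thesis using T by blast
    qed
    moreover have "\<Union>K \<subseteq> carrier G" "\<one> \<notin> \<Union>K" using KF by (auto simp: F_def)
    ultimately show "\<Union>K \<in> F" unfolding F_def by blast
  qed
  then obtain M where M: "M \<in> F"
    and maximal: "\<And>X. X \<in> F \<Longrightarrow> M \<subseteq> X \<Longrightarrow> X = M" by blast
  have Mc: "M \<subseteq> carrier G" "\<one> \<notin> M" "S \<subseteq> M"
    and Mm: "\<And>x y. x \<in> M \<Longrightarrow> y \<in> M \<Longrightarrow> x \<otimes> y \<in> M"
    using M by (auto simp: F_def)
  have Mpow: "s [^] n \<in> M" if s: "s \<in> M" and n: "n > 0" for s and n :: nat
    using n
  proof (induction n)
    case (Suc n)
    then show ?case using Mm s Mc by (cases "n = 0") auto
  qed simp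
  have neg: "\<exists>n>0. inv (x [^] (n::nat)) \<in> M" if x: "x \<in> carrier G" "x \<noteq> \<one>" "x \<notin> M" for x
  proof -
    define X where "X = {s \<otimes> x [^] (n::nat) | s n. s \<in> M \<or> (s = \<one> \<and> n > 0)}"
    have "M \<subseteq> X"
    proof
      fix s assume "s \<in> M"
      moreover from this have "s = s \<otimes> x [^] (0::nat)" using Mc by auto
      ultimately show "s \<in> X" unfolding X_def by blast
    qed
    moreover have "x \<in> X"
    proof -
      have "x = \<one> \<otimes> x [^] (1::nat)" using x by simp
      then show ?thesis unfolding X_def using zero_less_one by blast
    qed
    ultimately have "X \<notin> F" using maximal x(3) by blast
    moreover have "u \<otimes> v \<in> X" if "u \<in> X" "v \<in> X" for u v
    proof -
      obtain s m where u: "u = s \<otimes> x [^] (m::nat)" "s \<in> M \<or> (s = \<one> \<and> m > 0)" using \<open>u \<in> X\<close>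
        unfolding X_def by blast
      obtain t n where v: "v = t \<otimes> x [^] (n::nat)" "t \<in> M \<or> (t = \<one> \<and> n > 0)" using \<open>v \<in> X\<close>
        unfolding X_def by blast
      have c: "s \<in> carrier G" "t \<in> carrier G" using u v Mc by auto
      have "u \<otimes> v = (s \<otimes> t) \<otimes> x [^] (m + n)"
        using c x(1) u(1) v(1) by (simp add: nat_pow_mult [symmetric] m_ac)
      moreover have "s \<otimes> t \<in> M \<or> (s \<otimes> t = \<one> \<and> m + n > 0)" using u v Mm c by auto
      ultimately show ?thesis unfolding X_def by blast
    qed
    moreover have "X \<subseteq> carrier G" using Mc(1) x(1) by (auto simp: X_def)
    ultimately have "\<one> \<in> X" using Mc(3) \<open>M \<subseteq> X\<close> unfolding F_def by blast
    then obtain s n where sn: "\<one> = s \<otimes> x [^] (n::nat)" "s \<in> M \<or> (s = \<one> \<and> n > 0)" unfolding X_def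
      by blast
    have "s \<noteq> \<one>"
    proof
      assume "s = \<one>"
      then have "x [^] n = \<one>" "n > 0" using sn Mc x by auto
      then show False using torsion_free x by blast
    qed
    then have s: "s \<in> M" "s \<in> carrier G" using sn Mc by auto
    then have "s = inv (x [^] n)" using sn(1) x(1) inv_equality [of s "x [^] n"] by simp
    moreover have "n > 0"
    proof (rule ccontr)
      assume "\<not> n > 0"
      then show False using sn(1) s \<open>s \<noteq> \<one>\<close> by simp
    qed
    ultimately show ?thesis using s by blast
  qed
  have "x \<in> M \<or> inv x \<in> M" if x: "x \<in> carrier G" "x \<noteq> \<one>" for x
  proof (rule ccontr)
    assume n: "\<not> (x \<in> M \<or> inv x \<in> M)"
    obtain m :: nat where m: "m > 0" "inv (x [^] m) \<in> M" using neg x n by blast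
    have "inv x \<in> carrier G" "inv x \<noteq> \<one>" using x by auto
    then obtain k :: nat where "k > 0" "inv (inv x [^] k) \<in> M" using neg n by blast
    then have k: "k > 0" "x [^] k \<in> M" using x by (auto simp: nat_pow_inv)
    have "inv (x [^] m) [^] k \<in> M" "(x [^] k) [^] m \<in> M" using Mpow m k by auto
    then have "inv (x [^] m) [^] k \<otimes> (x [^] k) [^] m \<in> M" by (rule Mm)
    moreover have "inv (x [^] m) [^] k \<otimes> (x [^] k) [^] m = \<one>"
      using x by (simp add: nat_pow_inv nat_pow_pow mult.commute)
    ultimately show False using Mc by simp
  qed
  then have "M \<in> cones G" using Mc Mm by (auto simp: cones_def positive_cone_def)
  then show ?thesis using Mc by blast
qed

text \<open>
  Every real slope \<open>t\<close> gives an ordering in which \<open>x\<^sup>a y\<^sup>b\<close> is positive whenever \<open>a + b t > 0\<close>. A rational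
  number between two slopes provides an element on which the corresponding orderings disagree.
\<close>

lemma uncountable_cones_if_independent:
  assumes torsion_free: "\<And>x n. x \<in> carrier G \<Longrightarrow> n > 0 \<Longrightarrow> x [^] (n::nat) = \<one> \<Longrightarrow> x = \<one>"
    and xy: "x \<in> carrier G" "y \<in> carrier G"
    and ind: "\<And>(a::int) (b::int). x [^] a \<otimes> y [^] b = \<one> \<Longrightarrow> a = 0 \<and> b = 0"
  shows "uncountable (cones G)"
proof
  assume count: "countable (cones G)"
  define S where "S t = {x [^] a \<otimes> y [^] b | (a::int) (b::int). real_of_int a + real_of_int b * t > 0}" for t :: real
  have "\<exists>P\<in>cones G. S t \<subseteq> P" for t
  proof (rule extend_to_cone [OF torsion_free])
    show "S t \<subseteq> carrier G" using xy by (auto simp: S_def)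
    show "\<one> \<notin> S t"
    proof
      assume "\<one> \<in> S t"
      then obtain a b :: int
        where ab: "\<one> = x [^] a \<otimes> y [^] b" "real_of_int a + real_of_int b * t > 0"
        unfolding S_def by blast
      then show False using ind [of a b] by simp
    qed
    fix u v assume "u \<in> S t" "v \<in> S t"
    obtain a b :: int where u: "u = x [^] a \<otimes> y [^] b" "real_of_int a + real_of_int b * t > 0"
      using \<open>u \<in> S t\<close> unfolding S_def by blast
    obtain a' b' :: int where v: "v = x [^] a' \<otimes> y [^] b'" "real_of_int a' + real_of_int b' * t > 0"
      using \<open>v \<in> S t\<close> unfolding S_def by blast
    have "u \<otimes> v = x [^] (a + a') \<otimes> y [^] (b + b')"
      using u v xy by (simp add: int_pow_mult m_ac)
    moreover have "real_of_int (a + a') + real_of_int (b + b') * t > 0"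
      using u(2) v(2) by (simp add: algebra_simps)
    ultimately show "u \<otimes> v \<in> S t" unfolding S_def by blast
  qed
  then obtain C where C: "\<And>t. C t \<in> cones G" "\<And>t. S t \<subseteq> C t" by metis
  have neq: "C s \<noteq> C t" if st: "s < t" for s t
  proof
    assume eq: "C s = C t"
    obtain r where r: "r \<in> \<rat>" "s < r" "r < t" using Rats_dense_in_real [OF st] by blast
    obtain p q :: int where pq: "q > 0" "r = real_of_int p / real_of_int q"
      using Rats_cases' [OF r(1)] by metis
    have q: "real_of_int q > 0" using pq by simp
    have "real_of_int (-p) + real_of_int q * t > 0" "real_of_int p + real_of_int (-q) * s > 0"
      using r q pq(2) by (auto simp: field_simps)
    then have "x [^] (-p) \<otimes> y [^] q \<in> S t" "x [^] p \<otimes> y [^] (-q) \<in> S s"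
      unfolding S_def by blast+
    then have e: "x [^] (-p) \<otimes> y [^] q \<in> C t" "x [^] p \<otimes> y [^] (-q) \<in> C t"
      using C(2) eq by blast+
    interpret left_ordered_group G "C t"
      using C(1) by (intro left_ordered_groupI group_axioms)
    have "(x [^] (-p) \<otimes> y [^] q) \<otimes> (x [^] p \<otimes> y [^] (-q)) = (x [^] (-p) \<otimes> x [^] p) \<otimes> (y [^] q \<otimes> y [^] (-q))"
      using xy by (simp add: m_ac)
    also have "\<dots> = \<one>" using xy by (simp add: int_pow_mult [symmetric])
    finally show False using P_mult [OF e] one_notin_P by simp
  qed
  have "inj C"
  proof (rule injI)
    fix s t assume "C s = C t"
    then show "s = t" using neq [of s t] neq [of t s] by (metis linorder_neqE)
  qed
  moreover have "range C \<subseteq> cones G" using C(1) by blast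
  ultimately have "countable (UNIV :: real set)"
    using countable_image_inj_on [OF countable_subset [OF _ count]] by blast
  then show False using uncountable_UNIV_real by blast
qed

end

section \<open>Quotients of rank one\<close>

context normal
begin

lemma coset_eq_one_iff: "x \<in> carrier G \<Longrightarrow> H #> x = H \<longleftrightarrow> x \<in> H"
  using coset_join1 [OF _ _ subgroup_axioms] coset_join2 [OF _ subgroup_axioms] subset by auto

lemma group_hom_coset: "group_hom G (G Mod H) (\<lambda>x. H #> x)"
  using r_coset_hom_Mod factorgroup_is_group
  by (simp add: group_hom_def group_hom_axioms_def is_group)

text \<open>
  In terms of commutators it is visible that this property passes to intersections of subgroups.
\<close>

lemma comm_group_factor_iff:
  "comm_group (G Mod H) \<longleftrightarrow> (\<forall>x\<in>carrier G. \<forall>y\<in>carrier G. (x \<otimes> y) \<otimes> inv (y \<otimes> x) \<in> H)"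
proof -
  interpret p: group_hom G "G Mod H" "\<lambda>x. H #> x" by (rule group_hom_coset)
  have surj: "carrier (G Mod H) = (\<lambda>x. H #> x) ` carrier G" by (simp add: carrier_FactGroup)
  have *: "(H #> x) \<otimes>\<^bsub>G Mod H\<^esub> (H #> y) = (H #> y) \<otimes>\<^bsub>G Mod H\<^esub> (H #> x) \<longleftrightarrow> (x \<otimes> y) \<otimes> inv (y \<otimes> x) \<in> H"
    if c: "x \<in> carrier G" "y \<in> carrier G" for x y
  proof -
    have "(x \<otimes> y) \<otimes> inv (y \<otimes> x) \<in> H \<longleftrightarrow> H #> ((x \<otimes> y) \<otimes> inv (y \<otimes> x)) = \<one>\<^bsub>G Mod H\<^esub>"
      using coset_eq_one_iff [of "(x \<otimes> y) \<otimes> inv (y \<otimes> x)"] c by simp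
    also have "H #> ((x \<otimes> y) \<otimes> inv (y \<otimes> x)) = (H #> (x \<otimes> y)) \<otimes>\<^bsub>G Mod H\<^esub> inv\<^bsub>G Mod H\<^esub> (H #> (y \<otimes> x))"
      using p.hom_mult [of "x \<otimes> y" "inv (y \<otimes> x)"] p.hom_inv [of "y \<otimes> x"] c
        by (simp only: m_closed inv_closed)
    also have "\<dots> = \<one>\<^bsub>G Mod H\<^esub> \<longleftrightarrow> H #> (x \<otimes> y) = H #> (y \<otimes> x)"
    proof -
      have cl: "H #> (x \<otimes> y) \<in> carrier (G Mod H)" "H #> (y \<otimes> x) \<in> carrier (G Mod H)"
        using c p.hom_closed by blast+
      show ?thesis
        unfolding p.H.inv_solve_right' [OF p.H.one_closed cl] p.H.l_one [OF cl(2)] ..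
    qed
    also have "\<dots> \<longleftrightarrow> (H #> x) \<otimes>\<^bsub>G Mod H\<^esub> (H #> y) = (H #> y) \<otimes>\<^bsub>G Mod H\<^esub> (H #> x)"
      unfolding p.hom_mult [OF c] p.hom_mult [OF c(2,1)] ..
    finally show ?thesis by blast
  qed
  show ?thesis
  proof
    assume "comm_group (G Mod H)"
    then interpret C: comm_group "G Mod H" .
    show "\<forall>x\<in>carrier G. \<forall>y\<in>carrier G. (x \<otimes> y) \<otimes> inv (y \<otimes> x) \<in> H"
    proof (intro ballI)
      fix x y assume c: "x \<in> carrier G" "y \<in> carrier G"
      show "(x \<otimes> y) \<otimes> inv (y \<otimes> x) \<in> H"
        using C.m_comm [OF p.hom_closed [OF c(1)] p.hom_closed [OF c(2)]] unfolding * [OF c] .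
    qed
  next
    assume c: "\<forall>x\<in>carrier G. \<forall>y\<in>carrier G. (x \<otimes> y) \<otimes> inv (y \<otimes> x) \<in> H"
    show "comm_group (G Mod H)"
    proof (rule p.H.group_comm_groupI)
      fix a b assume ab: "a \<in> carrier (G Mod H)" "b \<in> carrier (G Mod H)"
      obtain x where x: "x \<in> carrier G" "a = H #> x" using ab(1) unfolding surj by blast
      obtain y where y: "y \<in> carrier G" "b = H #> y" using ab(2) unfolding surj by blast
      show "a \<otimes>\<^bsub>G Mod H\<^esub> b = b \<otimes>\<^bsub>G Mod H\<^esub> a"
        unfolding x(2) y(2) * [OF x(1) y(1)] using c x(1) y(1) by blast
    qed
  qed
qed

text \<open>
  The lexicographic ordering.
\<close>

definition lift_cone :: "'a set \<Rightarrow> 'a set set \<Rightarrow> 'a set" where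
  "lift_cone P Q = {g \<in> carrier G. H #> g \<in> Q} \<union> (P \<inter> H)"

lemma lift_cone:
  assumes P: "P \<in> cones G" and Q: "Q \<in> cones (G Mod H)"
  shows "lift_cone P Q \<in> cones G"
proof -
  interpret p: group_hom G "G Mod H" "\<lambda>x. H #> x" by (rule group_hom_coset)
  interpret P: left_ordered_group G P by (intro left_ordered_groupI P is_group)
  interpret Q: left_ordered_group "G Mod H" Q by (intro left_ordered_groupI Q p.H.group_axioms)
  have Hc: "x \<in> carrier G" if "x \<in> H" for x using that subset by blast
  have one: "H #> x = \<one>\<^bsub>G Mod H\<^esub>" if "x \<in> H" for x using coset_eq_one_iff [OF Hc [OF that]] that
    by simp
  have hom: "H #> (x \<otimes> y) = (H #> x) \<otimes>\<^bsub>G Mod H\<^esub> (H #> y)" if "x \<in> carrier G" "y \<in> carrier G" for x y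
    using p.hom_mult [OF that] .
  have 1: "x \<otimes> y \<in> lift_cone P Q" if x: "x \<in> lift_cone P Q" and y: "y \<in> lift_cone P Q" for x y
  proof -
    have c: "x \<in> carrier G" "y \<in> carrier G" using x y Hc by (auto simp: lift_cone_def)
    have ca: "H #> x \<in> carrier (G Mod H)" "H #> y \<in> carrier (G Mod H)" using c p.hom_closed
      by blast+
    consider "H #> x \<in> Q" "H #> y \<in> Q" | "H #> x \<in> Q" "y \<in> P \<inter> H" | "x \<in> P \<inter> H" "H #> y \<in> Q" | "x \<in> P \<inter> H" "y \<in> P \<inter> H"
      using x y unfolding lift_cone_def by blast
    then show ?thesis
    proof cases
      case 1
      then have "H #> (x \<otimes> y) \<in> Q" unfolding hom [OF c] by (rule Q.P_mult)
      then show ?thesis using c by (simp add: lift_cone_def)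
    next
      case 2
      then have "H #> (x \<otimes> y) = H #> x" unfolding hom [OF c] using one [of y] p.H.r_one [OF ca(1)]
        by (metis IntD2)
      then show ?thesis using c 2 by (simp add: lift_cone_def)
    next
      case 3
      then have "H #> (x \<otimes> y) = H #> y" unfolding hom [OF c] using one [of x] p.H.l_one [OF ca(2)]
        by (metis IntD2)
      then show ?thesis using c 3 by (simp add: lift_cone_def)
    next
      case 4
      then show ?thesis using P.P_mult by (simp add: lift_cone_def)
    qed
  qed
  have 2: "x \<in> lift_cone P Q \<or> inv x \<in> lift_cone P Q" if x: "x \<in> carrier G" "x \<noteq> \<one>" for x
  proof (cases "x \<in> H")
    case True
    then show ?thesis using P.P_total [OF x] by (auto simp: lift_cone_def)
  next
    case False
    then have "H #> x \<noteq> \<one>\<^bsub>G Mod H\<^esub>" using coset_eq_one_iff [OF x(1)] by simp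
    then have "H #> x \<in> Q \<or> inv\<^bsub>G Mod H\<^esub> (H #> x) \<in> Q" using Q.P_total p.hom_closed x(1) by blast
    then have "H #> x \<in> Q \<or> H #> inv x \<in> Q" using p.hom_inv [OF x(1)] by simp
    then show ?thesis using x by (auto simp: lift_cone_def)
  qed
  have 3: "\<one> \<notin> lift_cone P Q" using one [of \<one>] P.one_notin_P Q.one_notin_P
    by (auto simp: lift_cone_def)
  have "lift_cone P Q \<subseteq> carrier G" using subset by (auto simp: lift_cone_def)
  then show ?thesis unfolding cones_def positive_cone_def using 1 2 3 by simp
qed

lemma countable_cones_factor:
  assumes P: "P \<in> cones G" and count: "countable (cones G)"
  shows "countable (cones (G Mod H))"
proof -
  have "inj_on (lift_cone P) (cones (G Mod H))"
  proof (rule inj_onI)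
    have sub: "Q \<subseteq> R" if Q: "Q \<in> cones (G Mod H)" and eq: "lift_cone P Q = lift_cone P R" for Q R
    proof
      fix X assume X: "X \<in> Q"
      have "X \<in> carrier (G Mod H)" "H \<notin> Q" using X Q by (auto simp: cones_def positive_cone_def)
      then obtain x where x: "x \<in> carrier G" "X = H #> x" by (auto simp: carrier_FactGroup)
      have "X = H" if "x \<in> H" using coset_eq_one_iff [OF x(1)] x(2) that by simp
      then have "x \<notin> H" using X \<open>H \<notin> Q\<close> by blast
      moreover have "x \<in> lift_cone P R" using X x eq by (auto simp: lift_cone_def)
      ultimately show "X \<in> R" using x by (simp add: lift_cone_def)
    qed
    fix Q R assume "Q \<in> cones (G Mod H)" "R \<in> cones (G Mod H)" "lift_cone P Q = lift_cone P R"
    then show "Q = R" using sub [of Q R] sub [of R Q] by simp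
  qed
  moreover have "lift_cone P ` cones (G Mod H) \<subseteq> cones G" using lift_cone [OF P] by blast
  ultimately show ?thesis using countable_image_inj_on [OF countable_subset [OF _ count]] by blast
qed

text \<open>
  Every ordering of the quotient lifts, so an abelian torsion-free quotient of an orderable group
  with countably many orderings has countably many orderings itself
    and cannot have rank two or more.
\<close>

lemma dependent_mod:
  assumes P: "P \<in> cones G" and count: "countable (cones G)" and comm: "comm_group (G Mod H)"
    and root: "\<And>x n. x \<in> carrier G \<Longrightarrow> n > 0 \<Longrightarrow> x [^] (n::nat) \<in> H \<Longrightarrow> x \<in> H"
    and xy: "x \<in> carrier G" "y \<in> carrier G"
  shows "\<exists>(a::int) (b::int). (a \<noteq> 0 \<or> b \<noteq> 0) \<and> x [^] a \<otimes> y [^] b \<in> H"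
proof (rule ccontr)
  assume none: "\<not> ?thesis"
  interpret p: group_hom G "G Mod H" "\<lambda>x. H #> x" by (rule group_hom_coset)
  interpret C: comm_group "G Mod H" by (rule comm)
  have "uncountable (cones (G Mod H))"
  proof (rule C.uncountable_cones_if_independent)
    show "H #> x \<in> carrier (G Mod H)" "H #> y \<in> carrier (G Mod H)" using xy p.hom_closed by blast+
    fix a b :: int
    assume "(H #> x) [^]\<^bsub>G Mod H\<^esub> a \<otimes>\<^bsub>G Mod H\<^esub> (H #> y) [^]\<^bsub>G Mod H\<^esub> b = \<one>\<^bsub>G Mod H\<^esub>"
    then have "(H #> (x [^] a)) \<otimes>\<^bsub>G Mod H\<^esub> (H #> (y [^] b)) = H"
      unfolding FactGroup_int_pow [OF xy(1)] FactGroup_int_pow [OF xy(2)] by simp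
    then have "H #> (x [^] a \<otimes> y [^] b) = H"
      using p.hom_mult [of "x [^] a" "y [^] b"] xy by (simp only: int_pow_closed)
    then have "x [^] a \<otimes> y [^] b \<in> H"
      using coset_eq_one_iff [of "x [^] a \<otimes> y [^] b"] xy by blast
    then show "a = 0 \<and> b = 0" using none by blast
  next
    fix X and n :: nat
    assume X: "X \<in> carrier (G Mod H)" and n: "n > 0" "X [^]\<^bsub>G Mod H\<^esub> n = \<one>\<^bsub>G Mod H\<^esub>"
    obtain u where u: "u \<in> carrier G" "X = H #> u" using X by (auto simp: carrier_FactGroup)
    have "H #> (u [^] n) = H" using n(2) FactGroup_pow [OF u(1)] u(2) by simp
    then have "u \<in> H" using root [OF u(1) n(1)] coset_eq_one_iff u(1) by simp
    then show "X = \<one>\<^bsub>G Mod H\<^esub>" using coset_eq_one_iff u by simp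
  qed
  then show False using countable_cones_factor [OF P count] by blast
qed

end

section \<open>Groups with countably many orderings\<close>

lemma (in left_ordered_group) int_pow_in_cone_iff:
  assumes x: "x \<in> carrier G" "x \<noteq> \<one>" and a: "a \<noteq> (0::int)"
  shows "x [^] a \<in> P \<longleftrightarrow> (x \<in> P \<longleftrightarrow> a > 0)"
proof -
  have pos: "y [^] b \<in> P \<longleftrightarrow> b > 0" if y: "y \<in> P" and b: "b \<noteq> 0" for y and b :: int
  proof (cases "b > 0")
    case True
    then show ?thesis using pow_mono [OF y, of 0 b] by (simp add: P_iff)
  next
    case False
    then have "y [^] b \<prec> \<one>" using pow_mono [OF y, of b 0] b by simp
    then have "y [^] b \<notin> P" unfolding P_iff using less_trans less_irrefl by blast
    then show ?thesis using False by simp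
  qed
  show ?thesis
  proof (cases "x \<in> P")
    case True
    then show ?thesis using pos a by simp
  next
    case False
    then have i: "inv x \<in> P" using P_total x by blast
    have "x [^] a = inv x [^] (- a)" using x by (simp add: int_pow_inv int_pow_neg)
    then show ?thesis using pos [OF i, of "-a"] a False by auto
  qed
qed

lemma (in conradian_ordered_group) small_part_int_root:
  assumes nt: "carrier G \<noteq> {\<one>}" and g: "g \<in> carrier G" and n: "n \<noteq> (0::int)"
    and gn: "g [^] n \<in> small_part"
  shows "g \<in> small_part"
proof (cases "n > 0")
  case True
  then have "g [^] nat n \<in> small_part" using gn int_pow_int [of G g "nat n"] by simp
  then show ?thesis using small_part_root [OF g, of "nat n"] True by simp
next
  case False
  interpret N: subgroup small_part G by (rule subgroup_small_part [OF nt])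
  have "inv (g [^] n) \<in> small_part" using gn by (rule N.m_inv_closed)
  then have "g [^] (- n) \<in> small_part" using g by (simp add: int_pow_neg)
  then have "g [^] nat (- n) \<in> small_part" using int_pow_int [of G g "nat (-n)"] False by simp
  then show ?thesis using small_part_root [OF g, of "nat (-n)"] False n by simp
qed

lemma (in conradian_ordered_group) small_part_mult_iff:
  assumes nt: "carrier G \<noteq> {\<one>}" and c: "c \<in> small_part" and g: "g \<in> carrier G"
  shows "g \<otimes> c \<in> small_part \<longleftrightarrow> g \<in> small_part" "c \<otimes> g \<in> small_part \<longleftrightarrow> g \<in> small_part"
proof -
  interpret N: subgroup small_part G by (rule subgroup_small_part [OF nt])
  have cc: "c \<in> carrier G" using c by simp
  have "g = (g \<otimes> c) \<otimes> inv c" "g = inv c \<otimes> (c \<otimes> g)" using g cc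
    by (simp_all add: m_assoc) (simp add: m_assoc [symmetric])
  then show "g \<otimes> c \<in> small_part \<longleftrightarrow> g \<in> small_part" "c \<otimes> g \<in> small_part \<longleftrightarrow> g \<in> small_part"
    using N.m_closed N.m_inv_closed c by metis+
qed

text \<open>
  The quotient by the intersection \<open>K\<close> of the two small parts is again abelian
    and torsion-free, hence
  of rank at most one. Take \<open>x\<close> small for \<open>P\<close> and \<open>y\<close> not small for \<open>P\<close>. In a nontrivial relation
  \<open>x\<^sup>a y\<^sup>b \<in> K\<close> smallness for \<open>P\<close> forces \<open>b = 0\<close>, whence \<open>x\<^sup>a \<in> K\<close> with \<open>a \<noteq> 0\<close>,
    and \<open>x\<close> is small for \<open>Q\<close>.
\<close>

lemma small_part_subset:
  fixes G (structure)
  assumes G: "group G" and nt: "carrier G \<noteq> {\<one>}" and count: "countable (cones G)"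
    and P: "P \<in> cones G" and Q: "Q \<in> cones G"
  shows "conradian_ordered_group.small_part G P \<subseteq> conradian_ordered_group.small_part G Q"
proof
  interpret P: conradian_ordered_group G P by (rule conradian_if_countable_cones [OF G P count])
  interpret Q: conradian_ordered_group G Q by (rule conradian_if_countable_cones [OF G Q count])
  fix x assume x: "x \<in> P.small_part"
  let ?K = "P.small_part \<inter> Q.small_part"
  interpret NP: normal P.small_part G by (rule P.normal_small_part [OF nt])
  interpret NQ: normal Q.small_part G by (rule Q.normal_small_part [OF nt])
  have "?K \<lhd> G"
    unfolding P.normal_inv_iff
  proof (intro conjI ballI)
    show "subgroup ?K G" by (rule P.subgroups_Inter_pair [OF NP.subgroup_axioms NQ.subgroup_axioms])
    fix g c assume "g \<in> carrier G" "c \<in> ?K"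
    then show "g \<otimes> c \<otimes> inv g \<in> ?K" by (simp add: NP.inv_op_closed2 NQ.inv_op_closed2)
  qed
  then interpret K: normal ?K G .
  have comm: "comm_group (G Mod ?K)"
    using P.abelian_mod_small_part [OF nt] Q.abelian_mod_small_part [OF nt]
    unfolding K.comm_group_factor_iff NP.comm_group_factor_iff NQ.comm_group_factor_iff by blast
  have root: "u \<in> ?K" if "u \<in> carrier G" "n > 0" "u [^] n \<in> ?K" for u and n :: nat
    using P.small_part_root [OF that(1,2)] Q.small_part_root [OF that(1,2)] that(3) by blast
  have xc: "x \<in> carrier G" using x by simp
  obtain y where y: "y \<in> carrier G" "y \<notin> P.small_part"
    using P.exists_cofinal [OF P.finite_levels [OF count] nt] by blast
  have "\<exists>(a::int) (b::int). (a \<noteq> 0 \<or> b \<noteq> 0) \<and> x [^] a \<otimes> y [^] b \<in> ?K"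
    by (rule K.dependent_mod [OF P count comm _ xc y(1)]) (rule root)
  then obtain a b :: int where ab: "a \<noteq> 0 \<or> b \<noteq> 0" "x [^] a \<otimes> y [^] b \<in> ?K"
    by (elim exE conjE)
  have xa: "x [^] a \<in> P.small_part" using P.subgroup_int_pow_closed [OF NP.subgroup_axioms x] .
  have "y [^] b \<in> P.small_part" using P.small_part_mult_iff(2) [OF nt xa, of "y [^] b"] ab(2) y(1)
    by simp
  then have "b = 0" using P.small_part_int_root [OF nt y(1)] y(2) by blast
  then have "a \<noteq> 0" "x [^] a \<in> Q.small_part" using ab xc by auto
  then show "x \<in> Q.small_part" using Q.small_part_int_root [OF nt xc] by blast
qed

lemma small_part_unique:
  fixes G (structure)
  assumes "group G" "carrier G \<noteq> {\<one>}" "countable (cones G)" "P \<in> cones G" "Q \<in> cones G"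
  shows "conradian_ordered_group.small_part G P = conradian_ordered_group.small_part G Q"
  using small_part_subset [OF assms] small_part_subset [OF assms(1,2,3,5,4)]
    by (rule subset_antisym)

text \<open>
  Modulo the common small part \<open>C\<close> every element \<open>g\<close> outside \<open>C\<close> has a nonzero power equal to a nonzero
  power of \<open>h\<close>, and elements of \<open>C\<close> do not affect signs outside \<open>C\<close>. So the sign of \<open>h\<close> determines
  the sign of \<open>g\<close>.
\<close>

lemma cone_determined_by_small_part:
  fixes G (structure)
  assumes G: "group G" and nt: "carrier G \<noteq> {\<one>}" and count: "countable (cones G)"
    and Q: "Q \<in> cones G" and R: "R \<in> cones G"
    and C: "C = conradian_ordered_group.small_part G Q"
    and h: "h \<in> carrier G" "h \<notin> C"
    and agree: "Q \<inter> C = R \<inter> C" "h \<in> Q \<longleftrightarrow> h \<in> R"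
  shows "Q = R"
proof -
  interpret Q: conradian_ordered_group G Q by (rule conradian_if_countable_cones [OF G Q count])
  interpret R: conradian_ordered_group G R by (rule conradian_if_countable_cones [OF G R count])
  have C': "C = R.small_part" using small_part_unique [OF G nt count Q R] C by simp
  interpret N: normal C G unfolding C by (rule Q.normal_small_part [OF nt])
  have comm: "comm_group (G Mod C)" unfolding C by (rule Q.abelian_mod_small_part [OF nt])
  have root: "u \<in> C" if "u \<in> carrier G" "n > 0" "u [^] n \<in> C" for u and n :: nat
    using Q.small_part_root [OF that(1,2)] that(3) unfolding C by blast
  have introot: "u \<in> C" if "u \<in> carrier G" "n \<noteq> 0" "u [^] n \<in> C" for u and n :: int
    using Q.small_part_int_root [OF nt that(1,2)] that(3) unfolding C by blast
  have dominated: "u \<otimes> v \<in> Q \<longleftrightarrow> v \<in> Q" "u \<otimes> v \<in> R \<longleftrightarrow> v \<in> R"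
    if "u \<in> C" "v \<in> carrier G" "v \<notin> C" for u v
    using Q.dominant_factor(4) [of v u] Q.not_in_hull_of_small [of v u]
      R.dominant_factor(4) [of v u] R.not_in_hull_of_small [of v u] that N.mem_carrier [of u]
    unfolding C [symmetric] C' [symmetric] by auto
  have "g \<in> Q \<longleftrightarrow> g \<in> R" if g: "g \<in> carrier G" for g
  proof (cases "g \<in> C")
    case True
    then show ?thesis using agree(1) by blast
  next
    case False
    have "\<exists>(a::int) (b::int). (a \<noteq> 0 \<or> b \<noteq> 0) \<and> g [^] a \<otimes> h [^] b \<in> C"
      by (rule N.dependent_mod [OF Q count comm _ g h(1)]) (rule root)
    then obtain a b :: int where ab: "a \<noteq> 0 \<or> b \<noteq> 0" "g [^] a \<otimes> h [^] b \<in> C"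
      by (elim exE conjE)
    have mult_iff: "u \<otimes> v \<in> C \<longleftrightarrow> v \<in> C" "v \<otimes> u \<in> C \<longleftrightarrow> v \<in> C" if "u \<in> C" "v \<in> carrier G" for u v
      using Q.small_part_mult_iff [OF nt] that unfolding C by blast+
    have ne: "g \<noteq> \<one>" "h \<noteq> \<one>" using False h(2) N.one_closed by blast+
    have a: "a \<noteq> 0"
    proof
      assume a: "a = 0"
      then have "h [^] b \<in> C" using ab(2) h(1) by simp
      then show False using introot [OF h(1)] h(2) a ab(1) by blast
    qed
    have b: "b \<noteq> 0"
    proof
      assume b: "b = 0"
      then have "g [^] a \<in> C" using ab(2) g by simp
      then show False using introot [OF g] False b ab(1) by blast
    qed
    have hb: "h [^] (-b) \<in> carrier G" "h [^] (-b) \<notin> C" using introot [OF h(1), of "-b"] h b by auto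
    have ga: "g [^] a = (g [^] a \<otimes> h [^] b) \<otimes> h [^] (-b)"
      using g h(1) by (simp add: Q.m_assoc Q.int_pow_mult [symmetric])
    have "g [^] a \<in> Q \<longleftrightarrow> h [^] (-b) \<in> Q" "g [^] a \<in> R \<longleftrightarrow> h [^] (-b) \<in> R"
      using dominated [OF ab(2) hb] ga by simp_all
    then show ?thesis
      using Q.int_pow_in_cone_iff [OF g ne(1) a] R.int_pow_in_cone_iff [OF g ne(1) a]
        Q.int_pow_in_cone_iff [OF h(1) ne(2), of "-b"] R.int_pow_in_cone_iff [OF h(1) ne(2), of "-b"] b agree(2)
      by auto
  qed
  then show ?thesis using Q.P_carrier R.P_carrier by blast
qed

lemma restrict_cone:
  assumes G: "group G" and C: "subgroup C G" and P: "P \<in> cones G"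
  shows "P \<inter> C \<in> cones (G\<lparr>carrier := C\<rparr>)"
proof -
  interpret left_ordered_group G P by (intro left_ordered_groupI G P)
  interpret C: subgroup C G by (rule C)
  have "x \<in> P \<inter> C \<or> inv\<^bsub>G\<lparr>carrier := C\<rparr>\<^esub> x \<in> P \<inter> C" if "x \<in> C" "x \<noteq> \<one>\<^bsub>G\<^esub>" for x
    using P_total [of x] m_inv_consistent [OF C that(1)] C.m_inv_closed [OF that(1)] that C.mem_carrier by auto
  then show ?thesis
    unfolding cones_def positive_cone_def using P_mult one_notin_P by simp
qed

context conradian_ordered_group
begin

text \<open>
  Elements outside the small part dominate those inside, so the ordering inside can be exchanged
  without affecting the signs outside.
\<close>

lemma extend_cone:
  assumes nt: "carrier G \<noteq> {\<one>}" and R: "R \<in> cones (G\<lparr>carrier := small_part\<rparr>)"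
  shows "R \<union> (P - small_part) \<in> cones G"
proof -
  have sub: "subgroup small_part G" by (rule subgroup_small_part [OF nt])
  interpret N: subgroup small_part G by (rule sub)
  have Rsub: "R \<subseteq> small_part" and R1: "\<one> \<notin> R"
    and Rm: "\<And>x y. x \<in> R \<Longrightarrow> y \<in> R \<Longrightarrow> x \<otimes> y \<in> R"
    using R by (auto simp: cones_def positive_cone_def)
  have Rt: "x \<in> R \<or> inv x \<in> R" if "x \<in> small_part" "x \<noteq> \<one>" for x
    using R that m_inv_consistent [OF sub that(1)] by (auto simp: cones_def positive_cone_def)
  have big: "x \<otimes> y \<in> P - small_part" if "x \<in> P - small_part" "y \<in> P" for x y
  proof -
    have "x \<otimes> y \<notin> small_part" using mult_notin_small_part that by blast
    then show ?thesis using P_mult that by blast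
  qed
  have mixed: "x \<otimes> c \<in> P - small_part" "c \<otimes> x \<in> P - small_part" if x: "x \<in> P - small_part"
    and c: "c \<in> small_part" for x c
  proof -
    have xc: "x \<in> carrier G" "x \<notin> small_part" "x \<in> P" using x P_carrier by auto
    note d = dominant_factor [OF xc(1) N.mem_carrier [OF c] not_in_hull_of_small [OF xc(1,2) c]]
    show "x \<otimes> c \<in> P - small_part" "c \<otimes> x \<in> P - small_part"
      using d(3,4) xc(2,3) small_part_mult_iff [OF nt c xc(1)] by blast+
  qed
  have "x \<otimes> y \<in> R \<union> (P - small_part)"
    if "x \<in> R \<union> (P - small_part)" "y \<in> R \<union> (P - small_part)" for x y
    using that Rm [of x y] mixed(2) [of y x] mixed(1) [of x y] big [of x y] Rsub by blast
  moreover have "x \<in> R \<union> (P - small_part) \<or> inv x \<in> R \<union> (P - small_part)"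
    if "x \<in> carrier G" "x \<noteq> \<one>" for x
  proof (cases "x \<in> small_part")
    case True then show ?thesis using Rt that by blast
  next
    case False
    then have "inv x \<notin> small_part" using N.m_inv_closed [of "inv x"] that by auto
    then show ?thesis using P_total [OF that] False by blast
  qed
  moreover have "R \<union> (P - small_part) \<subseteq> carrier G" using Rsub N.subset P_carrier by blast
  ultimately show ?thesis
    unfolding cones_def positive_cone_def using R1 one_notin_P by simp
qed

lemma countable_cones_small_part:
  assumes nt: "carrier G \<noteq> {\<one>}" and count: "countable (cones G)"
  shows "countable (cones (G\<lparr>carrier := small_part\<rparr>))"
proof -
  have "inj_on (\<lambda>R. R \<union> (P - small_part)) (cones (G\<lparr>carrier := small_part\<rparr>))"
  proof (rule inj_onI)
    fix R S assume RS: "R \<in> cones (G\<lparr>carrier := small_part\<rparr>)" "S \<in> cones (G\<lparr>carrier := small_part\<rparr>)"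
      and eq: "R \<union> (P - small_part) = S \<union> (P - small_part)"
    have "R \<subseteq> small_part" "S \<subseteq> small_part" using RS by (auto simp: cones_def positive_cone_def)
    then show "R = S" using eq by blast
  qed
  moreover have "(\<lambda>R. R \<union> (P - small_part)) ` cones (G\<lparr>carrier := small_part\<rparr>) \<subseteq> cones G"
    using extend_cone [OF nt] by blast
  ultimately show ?thesis using countable_image_inj_on [OF countable_subset [OF _ count]] by blast
qed

text \<open>
  The hull of a small element is contained in the small part and is the same when computed there, so
  the levels of the small part are those of the group except the whole group itself.
\<close>

lemma card_levels_small_part:
  assumes nt: "carrier G \<noteq> {\<one>}" and count: "countable (cones G)"
  shows "card (conradian_ordered_group.levels (G\<lparr>carrier := small_part\<rparr>) (P \<inter> small_part)) < card levels"
proof -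
  let ?H = "G\<lparr>carrier := small_part\<rparr>"
  have sub: "subgroup small_part G" by (rule subgroup_small_part [OF nt])
  interpret N: subgroup small_part G by (rule sub)
  have H: "group ?H" using sub by (rule subgroup_imp_group)
  have "P \<in> cones G" using cone by (simp add: cones_def)
  then have PH: "P \<inter> small_part \<in> cones ?H" by (rule restrict_cone [OF is_group sub])
  interpret H: conradian_ordered_group ?H "P \<inter> small_part"
    by (rule conradian_if_countable_cones [OF H PH countable_cones_small_part [OF nt count]])
  have less: "H.less x y \<longleftrightarrow> x \<in> small_part \<and> y \<in> small_part \<and> x \<prec> y" for x y
    unfolding H.less_def less_def using m_inv_consistent [OF sub, of x] N.mem_carrier by auto
  have le: "H.less_eq x y \<longleftrightarrow> x \<in> small_part \<and> y \<in> small_part \<and> x \<preceq> y" for x y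
    unfolding H.less_eq_def less_eq_def less using N.mem_carrier by auto
  have hull: "H.power_hull h = power_hull h" if h: "h \<in> small_part" for h
  proof -
    have "power_hull h \<subseteq> small_part" using hull_of_small_part [OF N.mem_carrier [OF h] _ h] by blast
    moreover have "h [^] i \<in> small_part" for i :: int by (rule subgroup_int_pow_closed [OF sub h])
    moreover have "h [^]\<^bsub>?H\<^esub> i = h [^] i" for i :: int using int_pow_consistent [OF sub h] by simp
    ultimately show ?thesis unfolding H.power_hull_def le by (auto simp: power_hull_def)
  qed
  have "H.levels = power_hull ` (small_part - {\<one>})" unfolding H.levels_def using hull by auto
  then have "H.levels \<subseteq> levels" "carrier G \<notin> H.levels"
    unfolding levels_def small_part_def by auto
  moreover have "carrier G \<in> levels"
  proof -
    obtain g where g: "g \<in> carrier G" "g \<notin> small_part"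
      using exists_cofinal [OF finite_levels [OF count] nt] by blast
    have "power_hull g = carrier G" using g unfolding small_part_def by blast
    moreover have "g \<noteq> \<one>" using g(2) N.one_closed by blast
    ultimately show ?thesis using g(1) unfolding levels_def by blast
  qed
  ultimately have "H.levels \<subset> levels" by blast
  then show ?thesis by (rule psubset_card_mono [OF finite_levels [OF count]])
qed

end

text \<open>
  Induction on the number of levels of one ordering. Passing to the small part removes a level,
  and an ordering of the group is determined by its restriction to the small part together
  with one sign.
\<close>

theorem finite_cones_if_countable:
  assumes "group G" "countable (cones G)" "P \<in> cones G"
  shows "finite (cones G)"
  using assms
proof (induction "card (conradian_ordered_group.levels G P)" arbitrary: G P rule: less_induct)
  case less
  note G = less.prems(1) and count = less.prems(2) and P = less.prems(3)
  interpret conradian_ordered_group G P by (rule conradian_if_countable_cones [OF G P count])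
  show ?case
  proof (cases "carrier G = {\<one>\<^bsub>G\<^esub>}")
    case True
    have "cones G \<subseteq> Pow (carrier G)" by (auto simp: cones_def positive_cone_def)
    then show ?thesis by (rule finite_subset) (simp add: True)
  next
    case nt: False
    let ?H = "G\<lparr>carrier := small_part\<rparr>"
    have sub: "subgroup small_part G" by (rule subgroup_small_part [OF nt])
    have fin: "finite (cones ?H)"
      by (rule less.hyps [OF card_levels_small_part [OF nt count] subgroup_imp_group [OF sub]
            countable_cones_small_part [OF nt count] restrict_cone [OF G sub P]])
    obtain h where h: "h \<in> carrier G" "h \<notin> small_part"
      using exists_cofinal [OF finite_levels [OF count] nt] by blast
    let ?f = "\<lambda>Q. (Q \<inter> small_part, h \<in> Q)"
    have "inj_on ?f (cones G)"
    proof (rule inj_onI)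
      fix Q R assume Q: "Q \<in> cones G" and R: "R \<in> cones G" and eq: "?f Q = ?f R"
      have agree: "Q \<inter> small_part = R \<inter> small_part" "h \<in> Q \<longleftrightarrow> h \<in> R"
        using eq by simp_all
      show "Q = R"
        by (rule cone_determined_by_small_part [OF G nt count Q R small_part_unique [OF G nt count P Q] h agree])
    qed
    moreover have "?f ` cones G \<subseteq> cones ?H \<times> UNIV" using restrict_cone [OF G sub] by blast
    ultimately show ?thesis by (rule inj_on_finite) (simp add: fin)
  qed
qed

theorem theorem3p1:
  fixes \<Gamma> :: "('a, 'b) monoid_scheme"
  assumes "group \<Gamma>" and "orderable \<Gamma>" and "infinite (LO \<Gamma>)"
  shows "uncountable (LO \<Gamma>)"
proof
  assume "countable (LO \<Gamma>)"
  then have "countable (cones \<Gamma>)" by (rule countable_cones [OF assms(1)])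
  moreover obtain r where "r \<in> LO \<Gamma>" using assms(2) by (auto simp: orderable_def LO_def)
  ultimately have "finite (cones \<Gamma>)"
    using finite_cones_if_countable [OF assms(1)] LO_conv(1) [OF assms(1)] by blast
  then show False using finite_LO [OF assms(1)] assms(3) by blast
qed

end
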